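(* Let $I$ be an at most countable index set, let $\mathcal H$ be a separable Hilbert space, and let $\delta\ge 0$. Let $\{u_i\}_{i\in I}\subset\mathcal H$ be a Bessel sequence with bound $1$ whose elements have squared norm at most $\delta$, i.e. $$\sum_{i\in I}|\langle u,u_i\rangle|^2\le 1\quad\text{for all } u\in\mathcal H \text{ with }\|u\|=1,\qquad\text{and}\qquad \|u_i\|^2\le\delta\quad\text{for all } i\in I.$$ Then for any positive integer $r$ there exists a partition $\{I_1,\ldots,I_r\}$ of $I$ such that for each $k=1,\ldots,r$ the family $\{u_i\}_{i\in I_k}$ is a Bessel sequence with the bound $$\sum_{i\in I_k}|\langle u,u_i\rangle|^2\le\left(\frac1{\sqrt r}+\sqrt\delta\right)^2\qquad\text{for all } u\in\mathcal H\text{ with }\|u\|=1.$$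
   Context: A family $\{u_i\}_{i\in I}$ in a Hilbert space $\mathcal H$ is a Bessel sequence with bound $B$ if $\sum_{i\in I}|\langle u,u_i\rangle|^2\le B\|u\|^2$ for all $u\in\mathcal H$. Hilbert spaces are complex. Members of a partition are allowed to be empty. *)

theory Defs
  imports "HOL-Analysis.Analysis"
begin

class complex_vector = real_vector +
  fixes scaleC :: "complex \<Rightarrow> 'a \<Rightarrow> 'a"  (infixr \<open>*\<^sub>C\<close> 75)
  assumes scaleC_add_right: "c *\<^sub>C (x + y) = c *\<^sub>C x + c *\<^sub>C y"
    and scaleC_add_left: "(c + d) *\<^sub>C x = c *\<^sub>C x + d *\<^sub>C x"
    and scaleC_scaleC: "c *\<^sub>C (d *\<^sub>C x) = (c * d) *\<^sub>C x"
    and scaleC_one: "1 *\<^sub>C x = x"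
    and scaleR_scaleC: "r *\<^sub>R x = complex_of_real r *\<^sub>C x"

text \<open>The inner product is linear in the first argument. The triangle inequality inherited from
  \<open>real_normed_vector\<close> is redundant, since \<open>norm_eq_sqrt_cinner\<close> and the other axioms imply it.\<close>

class complex_inner = complex_vector + real_normed_vector +
  fixes cinner :: "'a \<Rightarrow> 'a \<Rightarrow> complex"
  assumes cinner_commute: "cinner x y = cnj (cinner y x)"
    and cinner_add_left: "cinner (x + y) z = cinner x z + cinner y z"
    and cinner_scaleC_left: "cinner (c *\<^sub>C x) y = c * cinner x y"
    and cinner_ge_zero: "0 \<le> Re (cinner x x)"
    and cinner_eq_zero_iff: "cinner x x = 0 \<longleftrightarrow> x = 0"
    and norm_eq_sqrt_cinner: "norm x = sqrt (Re (cinner x x))"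

class chilbert_space = complex_inner + complete_space
begin
subclass banach ..
end

instantiation complex :: chilbert_space
begin

definition scaleC_complex :: "complex \<Rightarrow> complex \<Rightarrow> complex"
  where "scaleC_complex c x = c * x"

definition cinner_complex :: "complex \<Rightarrow> complex \<Rightarrow> complex"
  where "cinner_complex x y = x * cnj y"

instance
  by standard
    (auto simp: scaleC_complex_def cinner_complex_def algebra_simps scaleR_conv_of_real
      cmod_def power2_eq_square)

end

lemma norm_scaleC: "norm (c *\<^sub>C x) = cmod c * norm (x :: 'a :: complex_inner)"
proof -
  have "cinner (c *\<^sub>C x) (c *\<^sub>C x) = c * cnj c * cinner x x"
    by (subst cinner_scaleC_left, subst cinner_commute, subst cinner_scaleC_left)
      (simp add: cinner_commute[of x x, symmetric])
  also have "\<dots> = complex_of_real ((cmod c)\<^sup>2) * cinner x x"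
    by (simp only: complex_norm_square)
  finally have "Re (cinner (c *\<^sub>C x) (c *\<^sub>C x)) = (cmod c)\<^sup>2 * Re (cinner x x)"
    by simp
  then show ?thesis
    by (simp add: norm_eq_sqrt_cinner[of x] norm_eq_sqrt_cinner[of "c *\<^sub>C x"] real_sqrt_mult)
qed

lemma cinner_zero_left [simp]: "cinner 0 (x :: 'a :: complex_inner) = 0"
  using cinner_add_left[of 0 0 x] by simp

text \<open>Summability is required explicitly because \<open>infsum\<close> of a non-summable family is \<open>0\<close>.\<close>

definition bessel_sequence :: "('i \<Rightarrow> 'a :: complex_inner) \<Rightarrow> 'i set \<Rightarrow> real \<Rightarrow> bool"
  where "bessel_sequence u I B \<longleftrightarrow>
    (\<forall>v. (\<lambda>i. (cmod (cinner v (u i)))\<^sup>2) summable_on I \<and>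
         (\<Sum>\<^sub>\<infinity>i\<in>I. (cmod (cinner v (u i)))\<^sup>2) \<le> B * (norm v)\<^sup>2)"

lemma bessel_sequence_iff_unit:
  "bessel_sequence u I B \<longleftrightarrow>
    (\<forall>v. norm v = 1 \<longrightarrow>
         (\<lambda>i. (cmod (cinner v (u i)))\<^sup>2) summable_on I \<and>
         (\<Sum>\<^sub>\<infinity>i\<in>I. (cmod (cinner v (u i)))\<^sup>2) \<le> B)" (is "_ \<longleftrightarrow> ?R")
proof
  assume "bessel_sequence u I B"
  then show ?R
    unfolding bessel_sequence_def by (metis mult.right_neutral one_power2)
next
  assume R: ?R
  show "bessel_sequence u I B"
    unfolding bessel_sequence_def
  proof
    fix v
    let ?f = "\<lambda>v i. (cmod (cinner v (u i)))\<^sup>2"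
    show "?f v summable_on I \<and> infsum (?f v) I \<le> B * (norm v)\<^sup>2"
    proof (cases "v = 0")
      case True
      then show ?thesis by simp
    next
      case False
      define w where "w = complex_of_real (inverse (norm v)) *\<^sub>C v"
      have w1: "norm w = 1"
        using False by (simp add: w_def norm_scaleC norm_inverse)
      have "complex_of_real (norm v) *\<^sub>C w = v"
        using False by (simp add: w_def scaleC_scaleC scaleC_one flip: of_real_mult)
      then have "cinner v (u i) = norm v * cinner w (u i)" for i
        by (metis cinner_scaleC_left)
      then have f: "?f v = (\<lambda>i. (norm v)\<^sup>2 * ?f w i)"
        by (simp add: norm_mult power_mult_distrib)
      have "?f w summable_on I" "infsum (?f w) I \<le> B"
        using R w1 by blast+
      then show ?thesis
        unfolding f
        using mult_left_mono[of "infsum (?f w) I" B "(norm v)\<^sup>2"]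
        by (simp add: infsum_cmult_right summable_on_cmult_right mult.commute)
    qed
  qed
qed

end

(*
  Marcus-Spielman-Srivastava. For finitely many vectors with Gram matrix G put
  f(x, z) = prod_k det (x 1 + diag (z_ik - x) G), a polynomial that is affine in every z_ik and has no
  zeros when all variables lie in the upper half plane. Averaging over the class k of vector i amounts
  to applying 1 - sum_k d/dz_ik, and fixing that class to be k amounts to applying 1 - r d/dz_ik, that is,
  to shifting z_ik by r. The multivariate barrier argument shows that the average over all
  vectors is positive on the diagonal from (1 + sqrt (r delta))^2 on.

  Classes are fixed one vector at a time without interlacing families: among the candidates
  g - r d_k g, one is positive at the threshold point because their average is, and it stays positive
  beyond because d_k g / g decreases. The monotonicity and convexity of such quotients along
  nonnegative directions come from their partial fractions, which have real poles and positive
  residues. Compactness of the space of colourings then passes to countable families.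
*)
theory Submission
  imports Defs "Jordan_Normal_Form.Char_Poly" "HOL-Computational_Algebra.Field_as_Ring"
    "HOL-Complex_Analysis.Great_Picard"
begin

section \<open>Rational functions mapping the upper half plane to the lower one\<close>

text \<open>Giving the deficit 1 - sum u_i u_i^* the variable x adapts the method to a Bessel bound:
  the family need not resolve the identity, and a positive x weighs what is missing. The scalar x is
  shared by all r factors, so nonvanishing of one product at a real point controls all classes at
  once. After the shifts the k-th factor on the diagonal is det (x 1 - r diag(1_S) G), where S is
  the k-th class. That it has no zero x >= (1 + sqrt (r delta))^2 bounds r times the class sum, and
  division by r produces the constant (1/sqrt r + sqrt delta)^2.

  This last conversion avoids spectral theory on an infinite-dimensional space: a valid bound is
  lowered as long as the determinant stays nonzero. The analytic input is one-dimensional: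
  restricting f and a partial derivative to a line with nonnegative direction gives two real
  polynomials in one variable, and the barrier estimates are statements about their
  quotient.\<close>

abbreviation cpoly :: "real poly \<Rightarrow> complex \<Rightarrow> complex"
  where "cpoly p \<equiv> poly (map_poly complex_of_real p)"

lemma cpoly_of_real [simp]: "cpoly p (complex_of_real t) = complex_of_real (poly p t)"
  by (induction p) (auto simp: map_poly_pCons)

lemma cpoly_cnj: "cpoly p (cnj t) = cnj (cpoly p t)"
  by (induction p) (auto simp: map_poly_pCons)

lemma
  shows map_poly_of_real_add: "map_poly complex_of_real (p + q) = map_poly complex_of_real p + map_poly
      complex_of_real q"
    and map_poly_of_real_mult: "map_poly complex_of_real (p * q) = map_poly complex_of_real p *
        map_poly complex_of_real q"
    and map_poly_of_real_power: "map_poly complex_of_real (p ^ n) = map_poly complex_of_real p ^ n"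
    and map_poly_of_real_eq_0_iff [simp]: "map_poly complex_of_real p = 0 \<longleftrightarrow> p = 0"
proof -
  interpret map_poly_inj_idom_hom complex_of_real ..
  show "map_poly complex_of_real (p + q) = map_poly complex_of_real p + map_poly complex_of_real q"
    "map_poly complex_of_real (p * q) = map_poly complex_of_real p * map_poly complex_of_real q"
    "map_poly complex_of_real (p ^ n) = map_poly complex_of_real p ^ n"
    "map_poly complex_of_real p = 0 \<longleftrightarrow> p = 0"
    by (simp_all only: hom_add hom_mult hom_power hom_0_iff)
qed

lemma degree_map_poly_of_real [simp]: "degree (map_poly complex_of_real p) = degree p"
  by (rule degree_map_poly) simp

lemma cpoly_mult: "cpoly (p * q) t = cpoly p t * cpoly q t"
  by (simp add: map_poly_of_real_mult)

lemma pderiv_map_poly_of_real: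
  "pderiv (map_poly complex_of_real p) = map_poly complex_of_real (pderiv p)"
  by (rule poly_eqI) (simp add: coeff_pderiv coeff_map_poly)

lemma Im_of_real_mult: "Im (complex_of_real r * z) = r * Im z"
  by simp

text \<open>For real polynomials this says that \<open>b / a\<close> maps the upper half plane to the
    closed lower one;
  clearing the denominator makes the condition stable under limits and allows common zeros.\<close>

definition anti_pick :: "(complex \<Rightarrow> complex) \<Rightarrow> (complex \<Rightarrow> complex)
    \<Rightarrow> bool"
  where "anti_pick a b \<longleftrightarrow> (\<forall>t. Im t > 0 \<longrightarrow> Im (b t * cnj (a
      t)) \<le> 0)"

text \<open>\<open>Im (b * cnj a)\<close> vanishes on the real axis and is nonpositive just above
  it, so its vertical derivative at a real point is nonpositive. That derivative is the Wronskian,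
  the numerator of the derivative of b / a.\<close>

lemma anti_pick_wronskian_le:
  assumes "anti_pick (cpoly a) (cpoly b)"
  shows "poly (pderiv b) t * poly a t \<le> poly b t * poly (pderiv a) t"
proof -
  let ?A = "map_poly complex_of_real a" and ?B = "map_poly complex_of_real b"
  define f where "f e = Im (poly ?B (of_real t + \<i> * of_real e) * cnj (poly ?A (of_real t + \<i> *
      of_real e)))"
    for e :: real
  have d: "((\<lambda>e. of_real t + \<i> * complex_of_real e) has_vector_derivative \<i>) (at 0)"
    by (auto intro!: derivative_eq_intros simp: has_vector_derivative_def scaleR_conv_of_real mult.commute)
  have "((\<lambda>e. poly p (of_real t + \<i> * of_real e)) has_vector_derivative \<i> * poly (pderiv
      p) (of_real t)) (at 0)" for p
    using field_vector_diff_chain_at[OF d, of "poly p"] by (simp add: o_def poly_DERIV)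
  from this[of "map_poly complex_of_real _"]
  have dp: "((\<lambda>e. cpoly p (of_real t + \<i> * of_real e)) has_vector_derivative \<i> * cpoly
      (pderiv p) (of_real t)) (at 0)" for p
    unfolding pderiv_map_poly_of_real .
  note dcnj = bounded_linear.has_vector_derivative[OF bounded_linear_cnj dp[of a]]
  have "((\<lambda>e. poly ?B (of_real t + \<i> * of_real e) * cnj (poly ?A (of_real t + \<i> * of_real e)))
     has_vector_derivative (\<i> * (of_real (poly (pderiv b) t * poly a t - poly b t * poly (pderiv a)
         t)))) (at 0)"
    by (rule has_vector_derivative_eq_rhs[OF has_vector_derivative_mult[OF dp dcnj]]) (simp add:
        algebra_simps)
  from bounded_linear.has_vector_derivative[OF bounded_linear_Im this]
  have df: "(f has_real_derivative (poly (pderiv b) t * poly a t - poly b t * poly (pderiv a) t)) (at 0)"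
    by (simp add: f_def[abs_def] has_real_derivative_iff_has_vector_derivative)
  have f0: "f 0 = 0" by (simp add: f_def)
  have fle: "f e \<le> 0" if "e > 0" for e
    using assms that unfolding anti_pick_def f_def by auto
  show ?thesis
  proof (rule ccontr)
    assume "\<not> ?thesis"
    then have "0 < poly (pderiv b) t * poly a t - poly b t * poly (pderiv a) t" by simp
    from DERIV_pos_inc_right[OF df this] obtain d where "d > 0" "\<And>h. h > 0 \<Longrightarrow> h < d
        \<Longrightarrow> f 0 < f (0 + h)"
      by auto
    from this(2)[of "d/2"] \<open>d > 0\<close> fle[of "d/2"] f0 show False by simp
  qed
qed

lemma has_real_derivative_poly_quotient:
  fixes a b :: "real poly"
  assumes "poly a t \<noteq> 0"
  shows "((\<lambda>t. poly b t / poly a t) has_real_derivative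
    (poly (pderiv b) t * poly a t - poly b t * poly (pderiv a) t) / (poly a t)\<^sup>2) (at t)"
  using assms by (auto intro!: derivative_eq_intros simp: power2_eq_square)

lemma anti_pick_quotient_antimono:
  assumes "anti_pick (cpoly a) (cpoly b)" "s \<le> t" "\<And>x. s \<le> x \<Longrightarrow> x \<le> t
      \<Longrightarrow> poly a x \<noteq> 0"
  shows "poly b t / poly a t \<le> poly b s / poly a s"
proof (rule DERIV_nonpos_imp_nonincreasing[OF assms(2)])
  fix x assume "s \<le> x" "x \<le> t"
  then show "\<exists>y. ((\<lambda>t. poly b t / poly a t) has_real_derivative y) (at x) \<and> y \<le> 0"
    using has_real_derivative_poly_quotient[of a x b] assms(3)[of x] anti_pick_wronskian_le[OF
        assms(1), of x]
    by (meson diff_le_0_iff_le divide_nonpos_nonneg zero_le_power2)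
qed

text \<open>Leading-order behaviour near a zero: on the ray y + e d the factor e^n is positive and
  can be divided out before e tends to 0. The hypothesis on d admits every direction when y is in
  the open upper half plane, and the upward directions when y is real.\<close>

lemma anti_pick_at_zero:
  assumes ap: "anti_pick (poly A) (poly B)"
    and A: "A = [:-y, 1:] ^ n * U"
    and d: "eventually (\<lambda>e. Im (y + of_real e * d) > 0) (at_right (0::real))"
  shows "Im (poly B y * cnj (poly U y) * cnj d ^ n) \<le> 0"
proof (rule tendsto_upperbound)
  let ?t = "\<lambda>e::real. y + of_real e * d"
  show "((\<lambda>e. Im (poly B (?t e) * cnj (poly U (?t e)) * cnj d ^ n)) \<longlongrightarrow>
      Im (poly B y * cnj (poly U y) * cnj d ^ n)) (at_right 0)"
  proof -
    have "(?t \<longlongrightarrow> y + of_real 0 * d) (at_right 0)" by (intro tendsto_intros)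
    then show ?thesis by (auto intro!: tendsto_intros)
  qed
  show "eventually (\<lambda>e. Im (poly B (?t e) * cnj (poly U (?t e)) * cnj d ^ n) \<le> 0) (at_right 0)"
    using d eventually_at_right_less[of 0]
  proof eventually_elim
    case (elim e)
    have "poly B (?t e) * cnj (poly A (?t e)) =
       of_real (e ^ n) * (poly B (?t e) * cnj (poly U (?t e)) * cnj d ^ n)"
      by (simp add: A poly_mult poly_power power_mult_distrib)
    then have "Im (poly B (?t e) * cnj (poly A (?t e))) = e ^ n * Im (poly B (?t e) * cnj (poly U (?t
        e)) * cnj d ^ n)"
      by (simp only: Im_of_real_mult)
    moreover have "Im (poly B (?t e) * cnj (poly A (?t e))) \<le> 0"
      using ap elim by (auto simp: anti_pick_def)
    ultimately have "e ^ n * Im (poly B (?t e) * cnj (poly U (?t e)) * cnj d ^ n) \<le> 0" by metis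
    moreover have "e ^ n > 0" using elim by simp
    ultimately show ?case by (metis mult_le_0_iff not_le)
  qed
qed simp

text \<open>Around an interior zero every direction d is admissible and \<open>cnj d ^ n\<close>
  takes every value, so the sign condition of \<open>anti_pick_at_zero\<close> can be
  violated.\<close>

lemma anti_pick_no_zero_upper:
  assumes ap: "anti_pick (poly A) (poly B)"
    and "A \<noteq> 0" "poly A y = 0" "poly B y \<noteq> 0"
  shows "Im y \<le> 0"
proof (rule ccontr)
  assume "\<not> Im y \<le> 0"
  then have y: "Im y > 0" by simp
  define n where "n = order y A"
  obtain U where A: "A = [:-y, 1:] ^ n * U" and U: "\<not> [:-y, 1:] dvd U"
    using order_decomp[OF \<open>A \<noteq> 0\<close>] n_def by blast
  have n: "n > 0" unfolding n_def using assms order_root by auto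
  have Uy: "poly U y \<noteq> 0" using U by (simp add: poly_eq_0_iff_dvd)
  define k where "k = poly B y * cnj (poly U y)"
  have k: "k \<noteq> 0" using Uy assms by (simp add: k_def)
  \<comment> \<open>The direction used below is \<open>cnj z\<close>, which makes the limiting
    quantity equal to i.\<close>
  obtain z where z: "z ^ n = \<i> / k"
    using nth_root_exists[of n "\<i> / k"] n by auto
  have "((\<lambda>e. Im (y + of_real e * cnj z)) \<longlongrightarrow> Im (y + of_real 0 * cnj z))
      (at_right (0::real))"
    by (intro tendsto_intros)
  then have "eventually (\<lambda>e. Im (y + of_real e * cnj z) > 0) (at_right (0::real))"
    using y by (intro order_tendstoD(1)) auto
  from anti_pick_at_zero[OF ap A this] have "Im (k * z ^ n) \<le> 0"
    by (simp add: k_def)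
  then show False using k by (simp add: z)
qed

text \<open>With the directions \<open>cis x\<close>, 0 < x < pi, the sign condition reads k sin (n
  x) >= 0. At x = pi / (2 n) the sine is 1, which gives the sign of k; for n >= 2 the point x = 3 pi
  / (2 n) is also in range and the sine there is -1. Hence the zero is simple, and the last
  conclusion is positivity of the residue of b / a.\<close>

lemma anti_pick_real_zero:
  fixes a b :: "real poly"
  assumes ap: "anti_pick (cpoly a) (cpoly b)"
    and "a \<noteq> 0" "poly a y = 0" "poly b y \<noteq> 0"
  obtains u where "a = [:-y, 1:] * u" "poly u y \<noteq> 0" "poly b y / poly u y > 0"
proof -
  define n where "n = order y a"
  obtain u where a: "a = [:-y, 1:] ^ n * u" and u: "\<not> [:-y, 1:] dvd u"
    using order_decomp[OF \<open>a \<noteq> 0\<close>] n_def by blast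
  have n: "n > 0" unfolding n_def using assms order_root by auto
  have uy: "poly u y \<noteq> 0" using u by (simp add: poly_eq_0_iff_dvd)
  define k where "k = poly b y * poly u y"
  have A: "map_poly complex_of_real a = [:- complex_of_real y, 1:] ^ n * map_poly complex_of_real u"
    by (simp add: a map_poly_of_real_mult map_poly_of_real_power map_poly_pCons)
  have sn: "k * sin (real n * x) \<ge> 0" if "0 < x" "x < pi" for x
  proof -
    have "eventually (\<lambda>e. Im (complex_of_real y + of_real e * cis x) > 0) (at_right (0::real))"
      using eventually_at_right_less[of "0::real"]
      by eventually_elim (use sin_gt_zero[OF that] in auto)
    from anti_pick_at_zero[OF ap A this]
    have "Im (of_real k * cnj (cis x) ^ n) \<le> 0"
      by (simp add: k_def)
    moreover have "cnj (cis x) ^ n = cis (real n * - x)"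
      by (simp only: cis_cnj Complex.DeMoivre)
    ultimately have "Im (of_real k * cis (real n * - x)) \<le> 0" by simp
    then show ?thesis by (simp only: Im_of_real_mult) simp
  qed
  have k0: "k \<noteq> 0" using uy assms by (simp add: k_def)
  have "k \<ge> 0"
    using sn[of "pi / (2 * real n)"] n by (simp add: field_simps)
  then have k: "k > 0" using k0 by simp
  have "n = 1"
  proof (rule ccontr)
    assume "n \<noteq> 1"
    with n have n2: "real n \<ge> 2" by linarith
    have "3 * pi / (2 * real n) < pi" using n2 pi_gt_zero by (simp add: field_simps)
    moreover have "0 < 3 * pi / (2 * real n)" using n2 by simp
    ultimately have "k * sin (real n * (3 * pi / (2 * real n))) \<ge> 0" by (rule sn[rotated])
    moreover have "real n * (3 * pi / (2 * real n)) = 3 / 2 * pi" using n by simp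
    ultimately have "k * sin (3 / 2 * pi) \<ge> 0" by metis
    moreover have "sin (3 / 2 * pi) = -1" using sin_3over2_pi by simp
    ultimately show False using k by simp
  qed
  with a have "a = [:-y, 1:] * u" by simp
  moreover have "poly b y / poly u y > 0" using k by (simp add: k_def zero_less_mult_iff
      zero_less_divide_iff)
  ultimately show ?thesis using that uy by blast
qed

section \<open>Partial fractions with real poles and positive residues\<close>

lemma coprime_cpoly_no_common_zero:
  assumes "coprime a b" "cpoly a y = 0"
  shows "cpoly b y \<noteq> 0"
proof
  assume "cpoly b y = 0"
  obtain p q where "p * a + q * b = 1"
    using bezout_coefficients_fst_snd[of a b] assms(1) by (metis coprime_imp_gcd_eq_1)
  then have "cpoly (p * a + q * b) y = 1" by simp
  then show False
    using assms(2) \<open>cpoly b y = 0\<close> by (simp add: map_poly_of_real_add map_poly_of_real_mult)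
qed

text \<open>A common factor multiplies \<open>b * cnj a\<close> by the positive number |g|^2 except
  at the isolated zeros of g, which a limit covers.\<close>

lemma anti_pick_cancel:
  assumes ap: "anti_pick (cpoly (g * a)) (cpoly (g * b))" and "g \<noteq> 0"
  shows "anti_pick (cpoly a) (cpoly b)"
  unfolding anti_pick_def
proof (intro allI impI)
  fix t :: complex assume t: "Im t > 0"
  have fin: "finite {z. cpoly g z = 0}"
    using \<open>g \<noteq> 0\<close> by (intro poly_roots_finite) simp
  have ev: "eventually (\<lambda>z. cpoly g z \<noteq> 0) (at t)"
    using islimpt_finite[OF fin, of t] by (simp add: islimpt_iff_eventually)
  have "((\<lambda>z. Im z) \<longlongrightarrow> Im t) (at t)" by (intro tendsto_intros)
  then have ev2: "eventually (\<lambda>z. Im z > 0) (at t)"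
    using t by (rule order_tendstoD)
  show "Im (cpoly b t * cnj (cpoly a t)) \<le> 0"
  proof (rule tendsto_upperbound)
    show "((\<lambda>z. Im (cpoly b z * cnj (cpoly a z))) \<longlongrightarrow> Im (cpoly b t * cnj
        (cpoly a t))) (at t)"
      by (intro tendsto_intros)
    show "eventually (\<lambda>z. Im (cpoly b z * cnj (cpoly a z)) \<le> 0) (at t)"
      using ev ev2
    proof eventually_elim
      case (elim z)
      have "cpoly (g * b) z * cnj (cpoly (g * a) z) = of_real ((cmod (cpoly g z))\<^sup>2) * (cpoly b z
          * cnj (cpoly a z))"
        by (simp only: cpoly_mult complex_norm_square complex_cnj_mult ac_simps)
      then have "Im (cpoly (g * b) z * cnj (cpoly (g * a) z)) = (cmod (cpoly g z))\<^sup>2 * Im (cpoly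
          b z * cnj (cpoly a z))"
        by (simp only: Im_of_real_mult)
      moreover have "Im (cpoly (g * b) z * cnj (cpoly (g * a) z)) \<le> 0"
        using ap elim by (auto simp: anti_pick_def)
      ultimately have "(cmod (cpoly g z))\<^sup>2 * Im (cpoly b z * cnj (cpoly a z)) \<le> 0" by metis
      moreover have "(cmod (cpoly g z))\<^sup>2 > 0" using elim by simp
      ultimately show ?case by (metis mult_le_0_iff not_le)
    qed
  qed simp
qed

text \<open>Zeros of a real polynomial come in conjugate pairs, and neither member of a pair may lie
  in the upper half plane.\<close>

lemma anti_pick_coprime_zero_real:
  assumes ap: "anti_pick (cpoly a) (cpoly b)" and "coprime a b" "a \<noteq> 0" "cpoly a y = 0"
  shows "y = complex_of_real (Re y)"
proof -
  have A: "map_poly complex_of_real a \<noteq> 0" using \<open>a \<noteq> 0\<close> by simp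
  have *: "Im z \<le> 0" if "cpoly a z = 0" for z
    using anti_pick_no_zero_upper[OF ap A that] coprime_cpoly_no_common_zero[OF \<open>coprime a
        b\<close> that] by blast
  have "cpoly a (cnj y) = 0" using assms by (simp add: cpoly_cnj)
  from *[OF this] *[of y] assms show ?thesis by (simp add: complex_eq_iff)
qed

lemma card_zeros_eq_degree:
  fixes a :: "real poly"
  assumes "a \<noteq> 0"
    and real: "\<And>z. cpoly a z = 0 \<Longrightarrow> z = complex_of_real (Re z)"
    and simple: "\<And>y. poly a y = 0 \<Longrightarrow> poly (pderiv a) y \<noteq> 0"
  shows "card {y. poly a y = 0} = degree a"
proof -
  let ?A = "map_poly complex_of_real a"
  have "rsquarefree ?A"
    unfolding rsquarefree_roots
  proof (intro allI notI, elim conjE)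
    fix z assume z: "poly ?A z = 0" "poly (pderiv ?A) z = 0"
    obtain y where y: "z = complex_of_real y" using real[OF z(1)] by blast
    have "poly a y = 0" "poly (pderiv a) y = 0"
      using z by (simp_all add: y pderiv_map_poly_of_real)
    then show False using simple by blast
  qed
  from complex_poly_decompose_rsquarefree[OF this]
  have "degree ?A = degree (Polynomial.smult (lead_coeff ?A) (\<Prod>z|poly ?A z = 0. [:-z, 1:]))" by simp
  also have "\<dots> = card {z. poly ?A z = 0}"
    using \<open>a \<noteq> 0\<close> by (simp add: degree_prod_eq_sum_degree)
  also have "{z. poly ?A z = 0} = complex_of_real ` {y. poly a y = 0}"
  proof (intro equalityI subsetI)
    fix z assume "z \<in> {z. poly ?A z = 0}"
    then have "poly ?A z = 0" by simp
    with real[OF this] show "z \<in> complex_of_real ` {y. poly a y = 0}"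
      by (metis (mono_tags, lifting) cpoly_of_real image_eqI mem_Collect_eq of_real_eq_0_iff)
  qed auto
  also have "card \<dots> = card {y. poly a y = 0}"
    by (simp add: card_image inj_on_def)
  finally show ?thesis by simp
qed

text \<open>Lagrange interpolation: all zeros of a are real and simple, so there are
  \<open>degree a\<close> of them, and a polynomial of smaller degree is determined by its values
  there. The quotients a / (X - y) form the interpolation basis, so \<open>b mod a\<close> is their
  combination with the residues as coefficients.\<close>

lemma anti_pick_partial_fractions:
  fixes a b :: "real poly"
  assumes ap: "anti_pick (cpoly a) (cpoly b)" and cop: "coprime a b" and "a \<noteq> 0"
  obtains q \<rho> where "\<forall>y. poly a y = 0 \<longrightarrow> \<rho> y > 0"
    "\<forall>t. poly a t \<noteq> 0 \<longrightarrow> poly b t / poly a t = poly q t + (\<Sum>y | poly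
        a y = 0. \<rho> y / (t - y))"
proof -
  define Y where "Y = {y. poly a y = 0}"
  have fY: "finite Y" using \<open>a \<noteq> 0\<close> by (simp add: Y_def poly_roots_finite)
  define u where "u y = a div [:-y, 1:]" for y
  have u: "a = [:-y, 1:] * u y" "poly (u y) y \<noteq> 0" "poly b y / poly (u y) y > 0" if "y \<in> Y" for y
  proof -
    have "poly b y \<noteq> 0"
      using coprime_cpoly_no_common_zero[OF cop, of "complex_of_real y"] that by (simp add: Y_def)
    from anti_pick_real_zero[OF ap \<open>a \<noteq> 0\<close> _ this] that
    obtain v where v: "a = [:-y, 1:] * v" "poly v y \<noteq> 0" "poly b y / poly v y > 0"
      by (auto simp: Y_def)
    have "u y = v" unfolding u_def v(1) by (rule nonzero_mult_div_cancel_left) simp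
    with v show "a = [:-y, 1:] * u y" "poly (u y) y \<noteq> 0" "poly b y / poly (u y) y > 0" by simp_all
  qed
  define \<rho> where "\<rho> y = poly b y / poly (u y) y" for y
  define L where "L = (\<Sum>y\<in>Y. Polynomial.smult (\<rho> y) (u y))"
  have card: "card Y = degree a"
    unfolding Y_def
  proof (rule card_zeros_eq_degree[OF \<open>a \<noteq> 0\<close>])
    fix y assume "poly a y = 0"
    then have y: "y \<in> Y" by (simp add: Y_def)
    have "pderiv a = pderiv ([:-y, 1:] * u y)" using u(1)[OF y] by simp
    also have "\<dots> = u y + [:-y, 1:] * pderiv (u y)" by (subst pderiv_mult) (simp add: pderiv_pCons)
    finally show "poly (pderiv a) y \<noteq> 0" using u(2)[OF y] by simp
  qed (use anti_pick_coprime_zero_real[OF ap cop \<open>a \<noteq> 0\<close>] in blast)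
  have PL: "poly L z = poly b z" if "z \<in> Y" for z
  proof -
    have "poly (Polynomial.smult (\<rho> y) (u y)) z = (if y = z then poly b z else 0)" if "y \<in> Y" for y
    proof (cases "y = z")
      case False
      have "poly a z = (z - y) * poly (u y) z" by (subst u(1)[OF that]) (simp add: algebra_simps)
      with False \<open>z \<in> Y\<close> show ?thesis by (simp add: Y_def)
    qed (use u(2)[OF \<open>z \<in> Y\<close>] in \<open>simp add: \<rho>_def\<close>)
    then have "poly L z = (\<Sum>y\<in>Y. if y = z then poly b z else 0)"
      by (simp add: L_def poly_sum)
    then show ?thesis using fY that by simp
  qed
  have "b mod a = L"
  proof (cases "degree a = 0")
    case True
    then have "Y = {}" using card fY by simp
    moreover have "b mod a = 0" using True \<open>a \<noteq> 0\<close>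
      by (meson is_unit_iff_degree unit_imp_mod_eq_0)
    ultimately show ?thesis by (simp add: L_def)
  next
    case False
    have d1: "degree (b mod a) < degree a" using degree_mod_less'[of a b] \<open>a \<noteq> 0\<close>
        False by force
    have "degree (Polynomial.smult (\<rho> y) (u y)) < degree a" if "y \<in> Y" for y
    proof -
      have "u y \<noteq> 0" using u(2)[OF that] by auto
      then have "degree a = 1 + degree (u y)" by (subst u(1)[OF that], subst degree_mult_eq) auto
      then show ?thesis using degree_smult_le[of "\<rho> y" "u y"] by simp
    qed
    then have d2: "degree L < degree a" unfolding L_def using False by (intro degree_sum_less) auto
    have d: "degree (b mod a - L) < degree a" using d1 d2 by (rule degree_diff_less)
    show ?thesis
    proof (rule ccontr)
      assume "b mod a \<noteq> L"
      then have nz: "b mod a - L \<noteq> 0" by simp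
      have "Y \<subseteq> {z. poly (b mod a - L) z = 0}"
      proof
        fix z assume z: "z \<in> Y"
        have "poly b z = poly (b div a * a + b mod a) z" by simp
        also have "\<dots> = poly (b mod a) z" unfolding poly_add poly_mult using z by (simp add: Y_def)
        finally show "z \<in> {z. poly (b mod a - L) z = 0}" using PL[OF z] by simp
      qed
      then have "card Y \<le> card {z. poly (b mod a - L) z = 0}"
        by (intro card_mono poly_roots_finite nz)
      also have "\<dots> \<le> degree (b mod a - L)" by (rule card_poly_roots_bound[OF nz])
      finally show False using d card by simp
    qed
  qed
  show ?thesis
  proof (rule that[of \<rho> "b div a"]; intro allI impI)
    fix t assume t: "poly a t \<noteq> 0"
    have "poly b t = poly (b div a * a + L) t" using \<open>b mod a = L\<close> by (metis div_mult_mod_eq)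
    also have "\<dots> = poly (b div a) t * poly a t + (\<Sum>y\<in>Y. \<rho> y * poly (u y) t)" by
        (simp add: L_def poly_sum)
    finally have "poly b t / poly a t = poly (b div a) t + (\<Sum>y\<in>Y. \<rho> y * poly (u y) t /
        poly a t)"
      using t by (simp add: add_divide_distrib sum_divide_distrib)
    also have "(\<Sum>y\<in>Y. \<rho> y * poly (u y) t / poly a t) = (\<Sum>y\<in>Y. \<rho> y / (t - y))"
    proof (rule sum.cong[OF refl])
      fix y assume y: "y \<in> Y"
      have "poly a t = (t - y) * poly (u y) t" by (subst u(1)[OF y]) (simp add: algebra_simps)
      with t show "\<rho> y * poly (u y) t / poly a t = \<rho> y / (t - y)" by simp
    qed
    finally show "poly b t / poly a t = poly (b div a) t + (\<Sum>y | poly a y = 0. \<rho> y / (t - y))"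
      by (simp add: Y_def)
  qed (use u(3) in \<open>auto simp: \<rho>_def Y_def\<close>)
qed

section \<open>Convexity of the quotients\<close>

lemma poly_bounded_imp_constant:
  fixes q :: "real poly"
  assumes "\<And>t. t \<ge> 0 \<Longrightarrow> \<bar>poly q t\<bar> \<le> C"
  shows "degree q = 0"
proof (rule ccontr)
  assume "degree q \<noteq> 0"
  then have "filterlim (poly q) at_infinity at_infinity" by (intro filterlim_poly_at_infinity) simp
  then have "filterlim (poly q) at_infinity at_top"
    by (rule filterlim_mono) (auto simp: at_top_le_at_infinity)
  then have "eventually (\<lambda>t. norm (poly q t) \<ge> C + 1) at_top"
    by (auto simp: filterlim_at_infinity_conv_norm_at_top filterlim_at_top)
  with eventually_ge_at_top[of 0] have "eventually (\<lambda>t::real. False) at_top"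
  proof eventually_elim
    case (elim t)
    then show ?case using assms[of t] by simp
  qed
  then show False by simp
qed

text \<open>Convexity of 1 / x: the tangent at s, evaluated at p, lies below the graph. Cleared of
  denominators it is (s - p)^2 >= 0.\<close>

lemma inverse_tangent_le:
  fixes p s :: real
  assumes "p > 0" "s > 0"
  shows "1 / s + (s - p) / s\<^sup>2 \<le> 1 / p"
proof -
  have "(s + (s - p)) * p = s\<^sup>2 - (s - p)\<^sup>2"
    by (simp add: power2_eq_square algebra_simps)
  then have "s + (s - p) \<le> s\<^sup>2 / p"
    by (intro mult_imp_le_div_pos assms(1)) simp
  then have "(s + (s - p)) / s\<^sup>2 \<le> 1 / p"
    using assms by (intro mult_imp_div_pos_le) simp_all
  moreover have "1 / s = s / s\<^sup>2" by (simp add: power2_eq_square)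
  ultimately show ?thesis by (simp only: add_divide_distrib)
qed

text \<open>Convexity of b / a on the half line, in the form of the tangent at t evaluated at 0. The
  poles are negative because a is positive on [0, infinity), each term \<rho> / (s - y) is convex to
  the right of its pole, and the polynomial part turns out to be constant.\<close>

lemma anti_pick_quotient_tangent:
  fixes a b :: "real poly"
  assumes ap: "anti_pick (cpoly a) (cpoly b)"
    and pos: "\<And>t. t \<ge> 0 \<Longrightarrow> poly a t > 0" and nonneg: "\<And>t. t \<ge> 0
        \<Longrightarrow> poly b t \<ge> 0"
    and "t > 0"
  shows "poly b t / poly a t - t * ((poly (pderiv b) t * poly a t - poly b t * poly (pderiv a) t) /
      (poly a t)\<^sup>2)
    \<le> poly b 0 / poly a 0"
proof -
  have a0: "a \<noteq> 0" using pos[of 0] by auto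
  define g where "g = gcd a b"
  have g0: "g \<noteq> 0" using a0 by (simp add: g_def)
  obtain a1 b1 where ab: "a = g * a1" "b = g * b1" and cop: "coprime a1 b1"
  proof -
    obtain a1 b1 where "a = a1 * g" "b = b1 * g" "coprime a1 b1"
      using gcd_coprime_exists[of a b] g0 unfolding g_def by blast
    then show ?thesis using that[of a1 b1] by (simp only: mult.commute)
  qed
  have ap1: "anti_pick (cpoly a1) (cpoly b1)" using ap g0 unfolding ab by (rule anti_pick_cancel)
  have a10: "a1 \<noteq> 0" using a0 ab by auto
  obtain q \<rho> where \<rho>: "\<forall>y. poly a1 y = 0 \<longrightarrow> \<rho> y > 0"
    and pf: "\<forall>t. poly a1 t \<noteq> 0 \<longrightarrow> poly b1 t / poly a1 t = poly q t +
        (\<Sum>y | poly a1 y = 0. \<rho> y / (t - y))"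
    by (rule anti_pick_partial_fractions[OF ap1 cop a10])
  define Y where "Y = {y. poly a1 y = 0}"
  have fY: "finite Y" using a10 by (simp add: Y_def poly_roots_finite)
  have Yneg: "y < 0" if "y \<in> Y" for y
    using pos[of y] that by (cases "y < 0") (auto simp: Y_def ab)
  have \<rho>Y: "\<rho> y \<ge> 0" if "y \<in> Y" for y using \<rho> that by (simp add: Y_def less_imp_le)
  have h: "poly b s / poly a s = poly q s + (\<Sum>y\<in>Y. \<rho> y / (s - y))" if "s \<ge> 0" for s
  proof -
    have "poly g s \<noteq> 0" "poly a1 s \<noteq> 0" using pos[OF that] by (auto simp: ab)
    then show ?thesis using pf by (simp add: ab Y_def)
  qed
  have S: "0 \<le> (\<Sum>y\<in>Y. \<rho> y / (s - y))" "(\<Sum>y\<in>Y. \<rho> y / (s - y)) \<le>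
      (\<Sum>y\<in>Y. \<rho> y / (0 - y))" if "s \<ge> 0" for s
  proof -
    show "0 \<le> (\<Sum>y\<in>Y. \<rho> y / (s - y))"
    proof (rule sum_nonneg)
      fix y assume "y \<in> Y"
      then show "0 \<le> \<rho> y / (s - y)" using \<rho>Y[of y] Yneg[of y] that by simp
    qed
    show "(\<Sum>y\<in>Y. \<rho> y / (s - y)) \<le> (\<Sum>y\<in>Y. \<rho> y / (0 - y))"
    proof (rule sum_mono)
      fix y assume "y \<in> Y"
      then show "\<rho> y / (s - y) \<le> \<rho> y / (0 - y)"
        using \<rho>Y[of y] Yneg[of y] that by (intro divide_left_mono mult_pos_pos) auto
    qed
  qed
  \<comment> \<open>The quotient b / a lies between 0 and its value at 0, and so does the sum over
    the poles; their difference \<open>q\<close> is therefore bounded on the half line.\<close>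
  have "\<bar>poly q s\<bar> \<le> poly b 0 / poly a 0 + (\<Sum>y\<in>Y. \<rho> y / (0 - y))" if s: "s
      \<ge> 0" for s
  proof -
    have "poly b s / poly a s \<le> poly b 0 / poly a 0"
    proof (rule anti_pick_quotient_antimono[OF ap s])
      show "poly a x \<noteq> 0" if "0 \<le> x" "x \<le> s" for x using pos[of x] that by simp
    qed
    moreover have "poly b s / poly a s \<ge> 0" using pos[OF s] nonneg[OF s] by simp
    moreover have "0 \<le> poly b 0 / poly a 0" using pos[of 0] nonneg[of 0] by simp
    ultimately show ?thesis using h[OF s] S[OF s] by linarith
  qed
  then have "degree q = 0" by (rule poly_bounded_imp_constant)
  then obtain c where q: "q = [:c:]" by (rule degree_eq_zeroE)
  define h' where "h' = - (\<Sum>y\<in>Y. \<rho> y / (t - y)\<^sup>2)"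
  have "((\<lambda>s. c + (\<Sum>y\<in>Y. \<rho> y / (s - y))) has_real_derivative (0 + (\<Sum>y\<in>Y.
      - \<rho> y / (t - y)\<^sup>2))) (at t)"
  proof (intro derivative_intros)
    fix y assume "y \<in> Y"
    then have "t - y \<noteq> 0" using Yneg[of y] \<open>t > 0\<close> by simp
    then show "((\<lambda>s. \<rho> y / (s - y)) has_real_derivative - \<rho> y / (t - y)\<^sup>2) (at t)"
      by (auto intro!: derivative_eq_intros simp: power2_eq_square)
  qed
  then have dh: "((\<lambda>s. c + (\<Sum>y\<in>Y. \<rho> y / (s - y))) has_real_derivative h') (at t)"
    by (simp add: h'_def sum_negf)
  have ev: "eventually (\<lambda>s. c + (\<Sum>y\<in>Y. \<rho> y / (s - y)) = poly b s / poly a s) (nhds t)"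
    using eventually_nhds_in_open[of "{0<..}" t] \<open>t > 0\<close>
    by (auto elim!: eventually_mono simp: h q)
  have dh2: "((\<lambda>s. poly b s / poly a s) has_real_derivative h') (at t)"
    by (rule iffD1[OF DERIV_cong_ev[OF refl ev refl] dh])
  have at: "poly a t \<noteq> 0" using pos[of t] \<open>t > 0\<close> by simp
  have h': "(poly (pderiv b) t * poly a t - poly b t * poly (pderiv a) t) / (poly a t)\<^sup>2 = h'"
    by (rule DERIV_unique[OF has_real_derivative_poly_quotient[OF at] dh2])
  have summand: "\<rho> y / (t - y) + t * (\<rho> y / (t - y)\<^sup>2) \<le> \<rho> y / (0 - y)" if y:
      "y \<in> Y" for y
  proof -
    have p: "- y > 0" using Yneg[OF y] by simp
    have "1 / (t - y) + t / (t - y)\<^sup>2 \<le> 1 / (0 - y)"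
      using inverse_tangent_le[of "- y" "t - y"] p \<open>t > 0\<close> by simp
    from mult_left_mono[OF this \<rho>Y[OF y]] show ?thesis
      by (simp only: distrib_left times_divide_eq_right mult_1_right mult.commute[of t])
  qed
  have "poly b t / poly a t - t * h' = c + (\<Sum>y\<in>Y. \<rho> y / (t - y) + t * (\<rho> y / (t -
      y)\<^sup>2))"
    using \<open>t > 0\<close> by (simp add: h q h'_def sum.distrib sum_distrib_left)
  also have "\<dots> \<le> c + (\<Sum>y\<in>Y. \<rho> y / (0 - y))" by (intro add_left_mono sum_mono
      summand)
  also have "\<dots> = poly b 0 / poly a 0" by (simp add: h q)
  finally show ?thesis by (simp add: h')
qed

section \<open>Stable polynomials that are affine in selected coordinates\<close>

text \<open>\<open>pd e\<close> is the partial derivative, but only for functions that are affine in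
    coordinate \<open>e\<close>.\<close>

definition pd :: "'e \<Rightarrow> (('e \<Rightarrow> complex) \<Rightarrow> complex) \<Rightarrow> ('e
    \<Rightarrow> complex) \<Rightarrow> complex"
  where "pd e f z = f (z(e := 1)) - f (z(e := 0))"

definition cvec :: "('e \<Rightarrow> real) \<Rightarrow> 'e \<Rightarrow> complex"
  where "cvec x = (\<lambda>e. complex_of_real (x e))"

text \<open>Polynomial restrictions to all complex lines stand in for multivariate polynomials, and
  real values at real points for real coefficients. The set \<open>E\<close> leaves room for a
  further coordinate, the x of the determinant, in which the function is a polynomial of higher
  degree.\<close>

definition affine_poly :: "'e set \<Rightarrow> (('e \<Rightarrow> complex) \<Rightarrow> complex)
    \<Rightarrow> bool"
  where "affine_poly E f \<longleftrightarrow>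
    (\<forall>e\<in>E. \<forall>z t. f (z(e := t)) = f (z(e := 0)) + t * pd e f z) \<and>
    (\<forall>x. f (cvec x) \<in> \<real>) \<and>
    (\<forall>z w. \<exists>p. \<forall>t. f (\<lambda>e. z e + t * w e) = poly p t)"

text \<open>Normalising the restriction to lines in the all-ones direction (monic of degree
    \<open>N\<close>) is preserved by
  \<open>1 - c \<partial>\<^sub>e\<close> and replaces any discussion of degenerate limits.\<close>

definition stable_poly :: "'e set \<Rightarrow> nat \<Rightarrow> (('e \<Rightarrow> complex)
    \<Rightarrow> complex) \<Rightarrow> bool"
  where "stable_poly E N f \<longleftrightarrow> affine_poly E f \<and>
    (\<forall>z. \<exists>p. degree p \<le> N \<and> coeff p N = 1 \<and> (\<forall>t. f (\<lambda>e. z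
        e + t) = poly p t)) \<and>
    (\<forall>z. (\<forall>e. Im (z e) > 0) \<longrightarrow> f z \<noteq> 0)"

definition diff_op :: "real \<Rightarrow> 'e set \<Rightarrow> (('e \<Rightarrow> complex)
    \<Rightarrow> complex) \<Rightarrow> ('e \<Rightarrow> complex) \<Rightarrow> complex"
  where "diff_op c S f z = f z - complex_of_real c * (\<Sum>e\<in>S. pd e f z)"

lemma pd_commute: "pd e (pd e' f) = pd e' (pd e f)"
  by (cases "e = e'") (auto simp: pd_def fun_upd_twist fun_eq_iff)

lemma pd_upd_same [simp]: "pd e f (z(e := t)) = pd e f z"
  by (simp add: pd_def)

lemma pd_pd_same: "pd e (pd e f) z = 0"
  by (simp add: pd_def)

lemma pd_pd: "pd e' (pd e f) z = pd e' f (z(e := 1)) - pd e' f (z(e := 0))"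
  by (subst pd_commute) (simp only: pd_def[of e])

lemma pd_diff_op: "pd e (diff_op c S f) = diff_op c S (pd e f)"
proof
  fix z
  show "pd e (diff_op c S f) z = diff_op c S (pd e f) z"
    by (simp only: pd_def[of e "diff_op c S f"] diff_op_def pd_pd sum_subtractf)
      (simp add: pd_def[of e f] algebra_simps)
qed

lemma diff_op_commute: "diff_op c S (diff_op d T f) = diff_op d T (diff_op c S f)"
proof
  fix z
  have "(\<Sum>e\<in>S. \<Sum>e'\<in>T. pd e' (pd e f) z) = (\<Sum>e\<in>T. \<Sum>e'\<in>S. pd e' (pd e
      f) z)"
    by (subst sum.swap) (intro sum.cong refl fun_cong[OF pd_commute])
  then show "diff_op c S (diff_op d T f) z = diff_op d T (diff_op c S f) z"
    unfolding diff_op_def[of _ _ "diff_op _ _ _"] pd_diff_op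
    by (simp only: diff_op_def sum_subtractf sum_distrib_left[symmetric]) (simp add: algebra_simps)
qed

lemma affine_polyD:
  assumes "affine_poly E f"
  shows "e \<in> E \<Longrightarrow> f (z(e := t)) = f (z(e := 0)) + t * pd e f z"
    and "f (cvec x) \<in> \<real>"
    and "\<exists>p. \<forall>t. f (\<lambda>e. z e + t * w e) = poly p t"
  using assms unfolding affine_poly_def by blast+

lemma affine_poly_upd:
  assumes "affine_poly E f" "e \<in> E"
  shows "f (z(e := z e + s)) = f z + s * pd e f z"
  using affine_polyD(1)[OF assms, of z "z e + s"] affine_polyD(1)[OF assms, of z "z e"]
  by (simp add: algebra_simps)

lemma affine_poly_pd:
  assumes "affine_poly E f"
  shows "affine_poly E (pd e f)"
  unfolding affine_poly_def
proof (intro conjI ballI allI)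
  fix e' z t assume e': "e' \<in> E"
  show "pd e f (z(e' := t)) = pd e f (z(e' := 0)) + t * pd e' (pd e f) z"
  proof (cases "e = e'")
    case False
    then have *: "pd e f (z(e' := c)) = f (z(e := 1, e' := c)) - f (z(e := 0, e' := c))" for c
      by (simp add: pd_def fun_upd_twist)
    show ?thesis
      unfolding * pd_pd affine_polyD(1)[OF assms e', of "z(e := 1)" t] affine_polyD(1)[OF assms e', of
          "z(e := 0)" t]
      by (simp add: algebra_simps)
  qed (simp add: pd_pd_same)
next
  fix x
  have "(cvec x)(e := 1) = cvec (x(e := 1))" "(cvec x)(e := 0) = cvec (x(e := 0))"
    by (auto simp: cvec_def)
  then show "pd e f (cvec x) \<in> \<real>"
    using affine_polyD(2)[OF assms] by (simp add: pd_def)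
next
  fix z w :: "_ \<Rightarrow> complex"
  \<comment> \<open>Freezing coordinate e turns a line into another line, with direction 0 in that
    coordinate.\<close>
  have *: "(\<lambda>e. z e + t * w e)(e := c) = (\<lambda>e'. (z(e := c)) e' + t * (w(e := 0)) e')" for t c
    by (auto simp: fun_eq_iff)
  obtain p q where "\<forall>t. f (\<lambda>e'. (z(e := 1)) e' + t * (w(e := 0)) e') = poly p t"
    "\<forall>t. f (\<lambda>e'. (z(e := 0)) e' + t * (w(e := 0)) e') = poly q t"
    using affine_polyD(3)[OF assms] by meson
  then show "\<exists>p. \<forall>t. pd e f (\<lambda>e. z e + t * w e) = poly p t"
    by (intro exI[of _ "p - q"]) (simp only: pd_def * poly_diff simp_thms)
qed

lemma affine_poly_diff_op:
  assumes "affine_poly E f" "finite S"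
  shows "affine_poly E (diff_op c S f)"
  unfolding affine_poly_def
proof (intro conjI ballI allI)
  fix e z t assume e: "e \<in> E"
  show "diff_op c S f (z(e := t)) = diff_op c S f (z(e := 0)) + t * pd e (diff_op c S f) z"
    unfolding pd_diff_op unfolding diff_op_def affine_polyD(1)[OF assms(1) e, of z t]
      affine_polyD(1)[OF affine_poly_pd[OF assms(1)] e, of _ z t]
    by (simp only: sum.distrib sum_distrib_left[symmetric] pd_commute[of e] algebra_simps)
next
  fix x show "diff_op c S f (cvec x) \<in> \<real>"
    unfolding diff_op_def using affine_polyD(2)[OF assms(1)] affine_polyD(2)[OF affine_poly_pd[OF assms(1)]]
    by (intro Reals_diff Reals_mult sum_in_Reals) auto
next
  fix z w
  obtain p where p: "\<forall>t. f (\<lambda>e'. z e' + t * w e') = poly p t"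
    using affine_polyD(3)[OF assms(1)] by blast
  have "\<forall>e. \<exists>p. \<forall>t. pd e f (\<lambda>e'. z e' + t * w e') = poly p t"
    using affine_polyD(3)[OF affine_poly_pd[OF assms(1)]] by blast
  then obtain q where q: "\<And>e t. pd e f (\<lambda>e'. z e' + t * w e') = poly (q e) t" by metis
  show "\<exists>p. \<forall>t. diff_op c S f (\<lambda>e. z e + t * w e) = poly p t"
    by (intro exI[of _ "p - Polynomial.smult (of_real c) (\<Sum>e\<in>S. q e)"]) (simp add: diff_op_def
        p q poly_sum)
qed

lemma stable_polyD:
  assumes "stable_poly E N f"
  shows "affine_poly E f"
    and "\<exists>p. degree p \<le> N \<and> coeff p N = 1 \<and> (\<forall>t. f (\<lambda>e. z e + t)
        = poly p t)"
    and "(\<And>e. Im (z e) > 0) \<Longrightarrow> f z \<noteq> 0"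
  using assms unfolding stable_poly_def by blast+

text \<open>In coordinate e the function is affine with a single zero, reached by the displacement s
  = - f / \<open>pd e f\<close>. Stability forbids that zero in the upper half plane, hence Im s <
  0, and \<open>pd e f z * cnj (f z)\<close> has imaginary part |\<open>pd e f z\<close>|^2 Im
  s.\<close>

lemma stable_poly_Im_pd:
  assumes f: "stable_poly E N f" and e: "e \<in> E" and z: "\<And>e. Im (z e) > 0" and nz: "pd e f z
      \<noteq> 0"
  shows "Im (pd e f z * cnj (f z)) < 0"
proof -
  define s where "s = - f z / pd e f z"
  have "s * pd e f z = - f z" using nz by (simp add: s_def)
  then have 0: "f (z(e := z e + s)) = 0"
    using affine_poly_upd[OF stable_polyD(1)[OF f] e, of z s] by simp
  have "\<not> Im (z e + s) > 0"
  proof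
    assume "Im (z e + s) > 0"
    then have "Im ((z(e := z e + s)) e') > 0" for e' using z[of e'] by auto
    then show False using stable_polyD(3)[OF f] 0 by blast
  qed
  then have "Im s < 0" using z[of e] by simp
  moreover have "pd e f z * cnj (f z) = - (of_real ((cmod (pd e f z))\<^sup>2) * cnj s)"
    using nz by (simp only: complex_norm_square) (simp add: s_def)
  then have "Im (pd e f z * cnj (f z)) = (cmod (pd e f z))\<^sup>2 * Im s"
    by (simp only: uminus_complex.sel Im_of_real_mult) simp
  ultimately show ?thesis using nz by (simp add: mult_pos_neg)
qed

text \<open>At a zero of the new function, the real number f cnj f equals c times the sum of the
  \<open>pd e f * cnj f\<close>. These have negative imaginary part unless they vanish, so all
  partial derivatives vanish, and then so does f.\<close>

lemma stable_poly_diff_op: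
  assumes f: "stable_poly E N f" and S: "finite S" "S \<subseteq> E" and c: "c \<ge> 0"
  shows "stable_poly E N (diff_op c S f)"
  unfolding stable_poly_def
proof (intro conjI allI impI)
  note af = stable_polyD(1)[OF f]
  show "affine_poly E (diff_op c S f)" by (rule affine_poly_diff_op[OF af S(1)])
  fix z
  show "\<exists>p. degree p \<le> N \<and> coeff p N = 1 \<and> (\<forall>t. diff_op c S f
      (\<lambda>e. z e + t) = poly p t)"
  proof -
    obtain p where p: "degree p \<le> N" "coeff p N = 1" "\<And>t. f (\<lambda>e. z e + t) = poly p t"
      using stable_polyD(2)[OF f] by blast
    have "\<forall>e. \<exists>p. degree p \<le> N \<and> coeff p N = 1 \<and> (\<forall>t. f
        (\<lambda>e'. (z(e := z e + 1)) e' + t) = poly p t)"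
      using stable_polyD(2)[OF f] by blast
    then obtain q where q: "\<And>e. degree (q e) \<le> N" "\<And>e. coeff (q e) N = 1"
      "\<And>e t. f (\<lambda>e'. (z(e := z e + 1)) e' + t) = poly (q e) t" by metis
    \<comment> \<open>On a diagonal line the partial derivative is a difference of two monic
      polynomials of degree N, so subtracting it keeps the coefficient 1 at N.\<close>
    have pdq: "pd e f (\<lambda>e. z e + t) = poly (q e) t - poly p t" if "e \<in> S" for e t
    proof -
      have "(\<lambda>e. z e + t)(e := (\<lambda>e. z e + t) e + 1) = (\<lambda>e'. (z(e := z e + 1))
          e' + t)" by auto
      then have "poly (q e) t = f ((\<lambda>e. z e + t)(e := (\<lambda>e. z e + t) e + 1))" by (simp
          only: q(3))
      also have "\<dots> = poly p t + 1 * pd e f (\<lambda>e. z e + t)"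
        using that S by (subst affine_poly_upd[OF af]) (auto simp: p(3))
      finally show ?thesis by simp
    qed
    define P where "P = p - Polynomial.smult (of_real c) (\<Sum>e\<in>S. q e - p)"
    have "degree P \<le> N"
      unfolding P_def using p(1) q(1) S
      by (intro degree_diff_le order.trans[OF degree_smult_le] degree_sum_le) auto
    moreover have "coeff P N = 1" by (simp add: P_def coeff_sum p(2) q(2))
    moreover have "diff_op c S f (\<lambda>e. z e + t) = poly P t" for t
      by (simp add: diff_op_def P_def poly_sum p(3) pdq)
    ultimately show ?thesis by blast
  qed
  assume z: "\<forall>e. Im (z e) > 0"
  show "diff_op c S f z \<noteq> 0"
  proof
    assume 0: "diff_op c S f z = 0"
    have fz: "f z \<noteq> 0" using stable_polyD(3)[OF f] z by blast
    have le: "Im (pd e f z * cnj (f z)) \<le> 0" if "e \<in> S" for e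
      using stable_poly_Im_pd[OF f, of e z] z that S by (cases "pd e f z = 0") (auto intro: less_imp_le)
    have "f z = of_real c * (\<Sum>e\<in>S. pd e f z)" using 0 by (simp add: diff_op_def)
    then have "f z * cnj (f z) = of_real c * (\<Sum>e\<in>S. pd e f z * cnj (f z))"
      by (simp only: sum_distrib_right mult.assoc)
    then have "Im (f z * cnj (f z)) = c * (\<Sum>e\<in>S. Im (pd e f z * cnj (f z)))"
      by (simp only: Im_of_real_mult Im_sum)
    moreover have "Im (f z * cnj (f z)) = 0" by simp
    moreover have "c \<noteq> 0" using 0 fz by (auto simp: diff_op_def)
    ultimately have "(\<Sum>e\<in>S. - Im (pd e f z * cnj (f z))) = 0" by (simp only: sum_negf) simp
    then have "\<forall>e\<in>S. Im (pd e f z * cnj (f z)) = 0"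
      using le by (subst (asm) sum_nonneg_eq_0_iff) (auto simp: S)
    then have "pd e f z = 0" if "e \<in> S" for e
      using stable_poly_Im_pd[OF f, of e z] z that S by fastforce
    then show False using 0 fz by (simp add: diff_op_def)
  qed
qed

section \<open>Barrier argument and selection\<close>

definition rval :: "(('e \<Rightarrow> complex) \<Rightarrow> complex) \<Rightarrow> ('e \<Rightarrow>
    real) \<Rightarrow> real"
  where "rval f x = Re (f (cvec x))"

text \<open>The points above all zeros in the sense of the multivariate barrier method. Positivity
  is demanded instead of nonvanishing; for stable polynomials \<open>above_zerosI_nonzero\<close>
  provides it, since they are positive far out on the diagonal.\<close>

definition above_zeros :: "(('e \<Rightarrow> complex) \<Rightarrow> complex) \<Rightarrow> ('e
    \<Rightarrow> real) \<Rightarrow> bool"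
  where "above_zeros f x \<longleftrightarrow> (\<forall>y. (\<forall>e. x e \<le> y e)
      \<longrightarrow> rval f y > 0)"

lemma above_zerosD: "above_zeros f x \<Longrightarrow> (\<And>e. x e \<le> y e) \<Longrightarrow> rval
    f y > 0"
  unfolding above_zeros_def by blast

lemma above_zeros_mono: "above_zeros f x \<Longrightarrow> (\<And>e. x e \<le> y e) \<Longrightarrow>
    above_zeros f y"
  unfolding above_zeros_def by (meson order_trans)

lemma of_real_rval: "affine_poly E f \<Longrightarrow> complex_of_real (rval f x) = f (cvec x)"
  unfolding rval_def by (rule of_real_Re) (rule affine_polyD(2))

lemma cvec_line: "cvec (\<lambda>e. x e + t * w e) = (\<lambda>e. cvec x e + complex_of_real t * cvec w e)"
  by (simp add: cvec_def fun_eq_iff)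

text \<open>The complex polynomial on the line is real at every real t. The polynomial formed by the
  real parts of its coefficients agrees with it at infinitely many points and therefore equals
  it.\<close>

lemma affine_poly_line:
  assumes "affine_poly E f"
  shows "\<exists>p. (\<forall>t. f (\<lambda>e. cvec x e + t * cvec w e) = cpoly p t) \<and>
    (\<forall>t. rval f (\<lambda>e. x e + t * w e) = poly p t)"
proof -
  obtain P where P: "\<And>t. f (\<lambda>e. cvec x e + t * cvec w e) = poly P t"
    using affine_polyD(3)[OF assms] by blast
  define p where "p = map_poly Re P"
  have real: "poly P (complex_of_real t) = of_real (rval f (\<lambda>e. x e + t * w e))" for t
    unfolding of_real_rval[OF assms] cvec_line P ..
  have Re: "poly (map_poly Re P) t = Re (poly P (complex_of_real t))" for t
    by (induction P) (auto simp: map_poly_pCons)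
  have pt: "rval f (\<lambda>e. x e + t * w e) = poly p t" for t
    by (simp add: p_def Re real)
  have "map_poly complex_of_real p = P"
  proof (rule ccontr)
    assume "map_poly complex_of_real p \<noteq> P"
    then have "finite {z. poly (map_poly complex_of_real p - P) z = 0}"
      by (intro poly_roots_finite) simp
    moreover have "range complex_of_real \<subseteq> {z. poly (map_poly complex_of_real p - P) z = 0}"
      by (auto simp: real pt)
    ultimately have "finite (range complex_of_real)" by (rule finite_subset[rotated])
    then have "finite (UNIV :: real set)" by (rule finite_imageD) (simp add: inj_def)
    then show False using infinite_UNIV_char_0 by blast
  qed
  then show ?thesis by (intro exI[of _ p]) (simp add: P pt)
qed

text \<open>Limit of \<open>stable_poly_Im_pd\<close> along z + i s with s tending to 0 from above.
  The closed half plane is needed because a direction with zero entries leaves some coordinates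
  real.\<close>

lemma stable_poly_Im_pd_closed:
  assumes f: "stable_poly E N f" and e: "e \<in> E" and z: "\<And>e. Im (z e) \<ge> 0"
  shows "Im (pd e f z * cnj (f z)) \<le> 0"
proof -
  note af = stable_polyD(1)[OF f]
  obtain p where p: "\<And>t. f (\<lambda>e. z e + t * 1) = poly p t"
    using affine_polyD(3)[OF af, of z "\<lambda>e. 1"] by blast
  obtain q where q: "\<And>t. pd e f (\<lambda>e. z e + t * 1) = poly q t"
    using affine_polyD(3)[OF affine_poly_pd[OF af], of e z "\<lambda>e. 1"] by blast
  let ?t = "\<lambda>s. \<i> * complex_of_real s"
  show ?thesis
  proof (rule tendsto_upperbound)
    show "((\<lambda>s. Im (poly q (?t s) * cnj (poly p (?t s)))) \<longlongrightarrow> Im (pd e f z *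
        cnj (f z))) (at_right 0)"
    proof -
      have "(?t \<longlongrightarrow> \<i> * of_real 0) (at_right 0)" by (intro tendsto_intros)
      moreover have "pd e f z = poly q 0" "f z = poly p 0" using p[of 0] q[of 0] by simp_all
      ultimately show ?thesis by (auto intro!: tendsto_intros)
    qed
    show "eventually (\<lambda>s. Im (poly q (?t s) * cnj (poly p (?t s))) \<le> 0) (at_right 0)"
      using eventually_at_right_less[of "0::real"]
    proof eventually_elim
      case (elim s)
      have "Im (z e' + ?t s * 1) > 0" for e' using z[of e'] elim by simp
      then have "Im (pd e f (\<lambda>e. z e + ?t s * 1) * cnj (f (\<lambda>e. z e + ?t s * 1))) \<le> 0"
        using stable_poly_Im_pd[OF f e, of "\<lambda>e. z e + ?t s * 1"]
        by (cases "pd e f (\<lambda>e. z e + ?t s * 1) = 0") (simp_all add: less_imp_le)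
      then show ?case by (simp only: p q)
    qed
  qed simp
qed

text \<open>The bridge to one variable: in a nonnegative direction the upper half plane of t is
  mapped into the closed upper half plane of every coordinate.\<close>

lemma stable_poly_line:
  assumes f: "stable_poly E N f" and e: "e \<in> E" and w: "\<And>e. w e \<ge> 0"
  shows "\<exists>a b. anti_pick (cpoly a) (cpoly b) \<and>
    (\<forall>t. f (\<lambda>e. cvec x e + t * cvec w e) = cpoly a t) \<and>
    (\<forall>t. pd e f (\<lambda>e. cvec x e + t * cvec w e) = cpoly b t) \<and>
    (\<forall>t. rval f (\<lambda>e. x e + t * w e) = poly a t) \<and>
    (\<forall>t. rval (pd e f) (\<lambda>e. x e + t * w e) = poly b t)"
proof -
  note af = stable_polyD(1)[OF f]
  obtain a where a: "\<And>t. f (\<lambda>e. cvec x e + t * cvec w e) = cpoly a t"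
    "\<And>t. rval f (\<lambda>e. x e + t * w e) = poly a t"
    using affine_poly_line[OF af, of x w] by blast
  obtain b where b: "\<And>t. pd e f (\<lambda>e. cvec x e + t * cvec w e) = cpoly b t"
    "\<And>t. rval (pd e f) (\<lambda>e. x e + t * w e) = poly b t"
    using affine_poly_line[OF affine_poly_pd[OF af], of e x w] by blast
  have ap: "anti_pick (cpoly a) (cpoly b)"
    unfolding anti_pick_def
  proof (intro allI impI)
    fix t :: complex assume "Im t > 0"
    then have "Im (cvec x e' + t * cvec w e') \<ge> 0" for e'
      using w[of e'] by (simp add: cvec_def)
    then show "Im (cpoly b t * cnj (cpoly a t)) \<le> 0"
      using stable_poly_Im_pd_closed[OF f e, of "\<lambda>e. cvec x e + t * cvec w e"] by (simp only: a b)
  qed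
  show ?thesis using ap a b by blast
qed

lemma rval_upd:
  assumes "affine_poly E f" "e \<in> E"
  shows "rval f (x(e := x e + s)) = rval f x + s * rval (pd e f) x"
proof -
  have *: "cvec (x(e := x e + s)) = (cvec x)(e := cvec x e + of_real s)"
    by (auto simp: cvec_def)
  show ?thesis unfolding rval_def * affine_poly_upd[OF assms] by simp
qed

lemma rval_diff_op: "rval (diff_op c S f) x = rval f x - c * (\<Sum>e\<in>S. rval (pd e f) x)"
  by (simp add: rval_def diff_op_def)

text \<open>If the slope in coordinate e were negative, raising that coordinate would bring the
  affine function down to 0 at a point still above x.\<close>

lemma above_zeros_pd_nonneg:
  assumes "affine_poly E f" "e \<in> E" "above_zeros f x" "\<And>e. x e \<le> y e"
  shows "rval (pd e f) y \<ge> 0"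
proof (rule ccontr)
  assume "\<not> ?thesis"
  then have n: "rval (pd e f) y < 0" by simp
  have p: "rval f y > 0" using above_zerosD assms(3,4) by blast
  define s where "s = - rval f y / rval (pd e f) y"
  have s: "s \<ge> 0" "s * rval (pd e f) y = - rval f y" using n p by (auto simp: s_def
      divide_nonneg_neg divide_nonpos_neg)
  have "rval f (y(e := y e + s)) > 0"
    using s(1) assms(4) by (intro above_zerosD[OF assms(3)]) (auto intro: add_increasing2)
  then show False using rval_upd[OF assms(1,2), of y s] s by simp
qed

lemma stable_poly_pd_quotient_antimono:
  assumes f: "stable_poly E N f" and e: "e \<in> E" and w: "\<And>e. w e \<ge> 0" and st: "s \<le> t"
    and nz: "\<And>u. s \<le> u \<Longrightarrow> u \<le> t \<Longrightarrow> rval f (\<lambda>e. x e +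
        u * w e) \<noteq> 0"
  shows "rval (pd e f) (\<lambda>e. x e + t * w e) / rval f (\<lambda>e. x e + t * w e)
    \<le> rval (pd e f) (\<lambda>e. x e + s * w e) / rval f (\<lambda>e. x e + s * w e)"
proof -
  obtain a b where ap: "anti_pick (cpoly a) (cpoly b)"
    and "\<And>t. f (\<lambda>e. cvec x e + t * cvec w e) = cpoly a t"
    "\<And>t. pd e f (\<lambda>e. cvec x e + t * cvec w e) = cpoly b t"
    and a: "\<And>t. rval f (\<lambda>e. x e + t * w e) = poly a t"
    and b: "\<And>t. rval (pd e f) (\<lambda>e. x e + t * w e) = poly b t"
    using stable_poly_line[where x = x and w = w, OF f e w] by blast
  show ?thesis unfolding a b
    by (rule anti_pick_quotient_antimono[OF ap st]) (use nz a in auto)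
qed

lemma above_zeros_pd_quotient_antimono:
  assumes f: "stable_poly E N f" and e: "e \<in> E" and ab: "above_zeros f x" and xy: "\<And>e. x e
      \<le> y e"
  shows "rval (pd e f) y / rval f y \<le> rval (pd e f) x / rval f x"
proof -
  have pos: "rval f (\<lambda>e. x e + u * (y e - x e)) > 0" if "0 \<le> u" for u
    by (intro above_zerosD[OF ab]) (simp add: that xy)
  have "rval f (\<lambda>e. x e + u * (y e - x e)) \<noteq> 0" if "0 \<le> u" "u \<le> 1" for u
    using pos[OF that(1)] by simp
  from stable_poly_pd_quotient_antimono[OF f e _ _ this, of 0 1] xy show ?thesis by simp
qed

text \<open>Ties the difference \<open>pd\<close> to calculus. Adding one coordinate to S turns the
  function into f + t \<open>pd e f\<close>, to which the product rule applies; affinity moves the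
  resulting terms back to the shifted point.\<close>

lemma has_field_derivative_indicator_line:
  assumes "affine_poly E f" "finite S" "S \<subseteq> E"
  shows "((\<lambda>t. f (\<lambda>e. z e + t * of_bool (e \<in> S))) has_field_derivative
    (\<Sum>e\<in>S. pd e f (\<lambda>e. z e + t * of_bool (e \<in> S)))) (at t)"
  using assms(2,1,3)
proof (induction S arbitrary: f rule: finite_induct)
  case (insert e S)
  define y where "y = (\<lambda>t e'. z e' + t * of_bool (e' \<in> S) :: complex)"
  have ye: "(\<lambda>e'. z e' + t * of_bool (e' \<in> insert e S)) = (y t)(e := y t e + t)" for t
    using insert.hyps by (auto simp: y_def)
  have e: "e \<in> E" using insert.prems by simp
  have af: "affine_poly E (pd e' f)" for e' by (rule affine_poly_pd[OF insert.prems(1)])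
  have eq: "f (\<lambda>e'. z e' + t * of_bool (e' \<in> insert e S)) = f (y t) + t * pd e f (y t)" for t
    unfolding ye by (rule affine_poly_upd[OF insert.prems(1) e])
  have "((\<lambda>t. f (y t) + t * pd e f (y t)) has_field_derivative
      (\<Sum>e'\<in>S. pd e' f (y t)) + (1 * pd e f (y t) + (\<Sum>e'\<in>S. pd e' (pd e f) (y t)) *
          t)) (at t)"
    unfolding y_def
    by (intro DERIV_add DERIV_mult DERIV_ident insert.IH insert.prems(1) af) (use insert.prems in auto)
  moreover have "(\<Sum>e'\<in>S. pd e' f (y t)) + (1 * pd e f (y t) + (\<Sum>e'\<in>S. pd e' (pd e f)
      (y t)) * t)
     = (\<Sum>e'\<in>insert e S. pd e' f ((y t)(e := y t e + t)))"
  proof -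
    have "pd e' f ((y t)(e := y t e + t)) = pd e' f (y t) + t * pd e' (pd e f) (y t)" for e'
      by (subst affine_poly_upd[OF af e]) (simp only: pd_commute[of e e'])
    then have "(\<Sum>e'\<in>insert e S. pd e' f ((y t)(e := y t e + t)))
      = (\<Sum>e'\<in>insert e S. pd e' f (y t)) + t * (\<Sum>e'\<in>insert e S. pd e' (pd e f) (y t))"
      by (simp only: sum.distrib sum_distrib_left)
    then show ?thesis using insert.hyps by (simp add: pd_pd_same algebra_simps)
  qed
  ultimately show ?case unfolding eq unfolding ye by simp
qed simp

text \<open>The multivariate barrier step: the loss caused by \<open>1 - \<partial>\<^sub>S\<close> is
    at most the derivative of the
  barrier in direction \<open>S\<close>, which convexity recovers by moving \<open>d\<close> in that
      direction.\<close>

lemma barrier_step: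
  assumes f: "stable_poly E N f" and S: "finite S" "S \<subseteq> E" and d: "d > 0"
    and ab: "above_zeros f x" and le: "(\<Sum>e\<in>S. rval (pd e f) x / rval f x) \<le> 1 - 1 / d"
  defines "x' \<equiv> \<lambda>e. x e + d * of_bool (e \<in> S)"
  shows "above_zeros (diff_op 1 S f) x'"
    and "e \<in> E \<Longrightarrow> rval (pd e (diff_op 1 S f)) x' / rval (diff_op 1 S f) x' \<le>
        rval (pd e f) x / rval f x"
proof -
  note af = stable_polyD(1)[OF f]
  have xx': "x e \<le> x' e" for e using d by (simp add: x'_def)
  define \<Phi> where "\<Phi> y = (\<Sum>e\<in>S. rval (pd e f) y / rval f y)" for y
  have \<Phi>: "\<Phi> y \<le> 1 - 1 / d" "rval (diff_op 1 S f) y = rval f y * (1 - \<Phi> y)" "rval f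
      y > 0" if "\<And>e. x e \<le> y e" for y
  proof -
    have "\<Phi> y \<le> \<Phi> x" unfolding \<Phi>_def
      using S by (intro sum_mono above_zeros_pd_quotient_antimono[OF f _ ab that]) auto
    then show "\<Phi> y \<le> 1 - 1 / d" using le unfolding \<Phi>_def by linarith
    show p: "rval f y > 0" using above_zerosD[OF ab] that by blast
    show "rval (diff_op 1 S f) y = rval f y * (1 - \<Phi> y)"
      using p by (simp add: rval_diff_op \<Phi>_def right_diff_distrib sum_distrib_left)
  qed
  have pos: "1 - \<Phi> y > 0" if "\<And>e. x e \<le> y e" for y
  proof -
    have "1 / d > 0" using d by simp
    then show ?thesis using \<Phi>(1)[OF that] by linarith
  qed
  show "above_zeros (diff_op 1 S f) x'"
    unfolding above_zeros_def
  proof (intro allI impI)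
    fix y assume "\<forall>e. x' e \<le> y e"
    then have "\<And>e. x e \<le> y e" using xx' order_trans by blast
    then show "rval (diff_op 1 S f) y > 0" using \<Phi>[of y] pos[of y] by simp
  qed
  assume e: "e \<in> E"
  define w where "w = (\<lambda>e. of_bool (e \<in> S) :: real)"
  obtain a b where ap: "anti_pick (cpoly a) (cpoly b)"
    and ca: "\<And>t. f (\<lambda>e. cvec x e + t * cvec w e) = cpoly a t"
    and cb: "\<And>t. pd e f (\<lambda>e. cvec x e + t * cvec w e) = cpoly b t"
    and a: "\<And>t. rval f (\<lambda>e. x e + t * w e) = poly a t"
    and b: "\<And>t. rval (pd e f) (\<lambda>e. x e + t * w e) = poly b t"
    using stable_poly_line[OF f e, of w x] by (auto simp: w_def)
  have cw: "cvec w = (\<lambda>e. of_bool (e \<in> S))" by (auto simp: cvec_def w_def)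
  have x': "x' = (\<lambda>e. x e + d * w e)" by (simp add: x'_def w_def)
  have cx': "(\<lambda>e. cvec x e + of_real d * of_bool (e \<in> S)) = cvec x'"
    by (simp add: x'_def cvec_def fun_eq_iff)
  \<comment> \<open>The derivative in t along the indicator of S is the sum of the \<open>pd\<close>
    over S; it is used both for f and for \<open>pd e f\<close>.\<close>
  have der: "poly (pderiv p) d = (\<Sum>e\<in>S. rval (pd e g) x')"
    if g: "affine_poly E g" and gp: "\<And>t. g (\<lambda>e. cvec x e + t * cvec w e) = cpoly p t" for g p
  proof -
    have "((\<lambda>t. cpoly p t) has_field_derivative (\<Sum>e\<in>S. pd e g (cvec x'))) (at (of_real d))"
      using has_field_derivative_indicator_line[OF g S, of "cvec x" "of_real d"]
      unfolding gp[unfolded cw] cx' .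
    moreover have "((\<lambda>t. cpoly p t) has_field_derivative cpoly (pderiv p) (of_real d)) (at
        (of_real d))"
      unfolding pderiv_map_poly_of_real[symmetric] by (rule poly_DERIV)
    ultimately have "cpoly (pderiv p) (of_real d) = (\<Sum>e\<in>S. pd e g (cvec x'))"
      by (rule DERIV_unique[rotated])
    then have "complex_of_real (poly (pderiv p) d) = (\<Sum>e\<in>S. pd e g (cvec x'))" by simp
    then have "Re (complex_of_real (poly (pderiv p) d)) = Re (\<Sum>e\<in>S. pd e g (cvec x'))" by
        (rule arg_cong)
    then show ?thesis by (simp only: Re_complex_of_real Re_sum rval_def)
  qed
  have fx: "rval f x = poly a 0" "rval (pd e f) x = poly b 0" using a[of 0] b[of 0] by simp_all
  have fx': "rval f x' = poly a d" "rval (pd e f) x' = poly b d" using a[of d] b[of d] x' by simp_all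
  have apos: "poly a t > 0" if "t \<ge> 0" for t
    unfolding a[symmetric] by (rule above_zerosD[OF ab]) (simp add: that w_def)
  have bpos: "poly b t \<ge> 0" if "t \<ge> 0" for t
    unfolding b[symmetric] by (rule above_zeros_pd_nonneg[OF af e ab]) (simp add: that w_def)
  \<comment> \<open>The slope at d of the barrier b / a of coordinate e along the direction
    S.\<close>
  define h' where "h' = (poly (pderiv b) d * poly a d - poly b d * poly (pderiv a) d) / (poly a d)\<^sup>2"
  have tangent: "poly b d / poly a d - d * h' \<le> poly b 0 / poly a 0"
    unfolding h'_def by (rule anti_pick_quotient_tangent[OF ap apos bpos d])
  have h'0: "h' \<le> 0"
    unfolding h'_def using anti_pick_wronskian_le[OF ap, of d]
    by (intro divide_nonpos_nonneg) auto
  have ad: "poly a d > 0" using apos d by simp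
  have da: "poly (pderiv a) d = poly a d * \<Phi> x'"
    using der[OF af ca] ad by (simp add: \<Phi>_def fx' sum_distrib_left)
  have db: "poly (pderiv b) d = (\<Sum>e'\<in>S. rval (pd e' (pd e f)) x')"
    by (rule der[OF affine_poly_pd[OF af] cb])
  have "h' = (poly a d * (poly (pderiv b) d - poly b d * \<Phi> x')) / (poly a d * poly a d)"
    unfolding h'_def da power2_eq_square by (simp only: right_diff_distrib mult.commute mult.left_commute)
  then have "poly a d * h' = poly (pderiv b) d - poly b d * \<Phi> x'" using ad by simp
  then have db': "poly (pderiv b) d = poly a d * h' + poly b d * \<Phi> x'" by simp
  have "rval (pd e (diff_op 1 S f)) x' = poly b d - (poly a d * h' + poly b d * \<Phi> x')"
    unfolding pd_diff_op rval_diff_op fx' using db db' by simp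
  also have "\<dots> = poly b d * (1 - \<Phi> x') - poly a d * h'" by (simp add: algebra_simps)
  finally have num: "rval (pd e (diff_op 1 S f)) x' = poly b d * (1 - \<Phi> x') - poly a d * h'" .
  define q where "q = 1 - \<Phi> x'"
  have den: "rval (diff_op 1 S f) x' = poly a d * q" using \<Phi>(2)[of x'] xx' fx' by (simp add: q_def)
  have q: "q > 0" using pos xx' by (simp add: q_def)
  \<comment> \<open>The new barrier is b / a - h' / q. As -h' >= 0 and 1 / q <= d, it is at most b /
    a - d h', the tangent at d evaluated at 0.\<close>
  have "1 / d \<le> q" using \<Phi>(1)[of x'] xx' by (simp add: q_def)
  then have "1 / q \<le> d" using d q by (simp add: pos_divide_le_eq mult.commute)
  then have "(- h') * (1 / q) \<le> (- h') * d" using h'0 by (intro mult_left_mono) auto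
  moreover have "rval (pd e (diff_op 1 S f)) x' / rval (diff_op 1 S f) x' = poly b d / poly a d + (-
      h') * (1 / q)"
    unfolding num q_def[symmetric] den using ad q by (simp add: diff_divide_distrib)
  ultimately have "rval (pd e (diff_op 1 S f)) x' / rval (diff_op 1 S f) x' \<le> poly b d / poly a d -
      d * h'"
    by (simp only: mult_minus_left mult.commute[of h'])
  then show "rval (pd e (diff_op 1 S f)) x' / rval (diff_op 1 S f) x' \<le> rval (pd e f) x / rval f x"
    using tangent unfolding fx by (rule order_trans)
qed

lemma stable_poly_eventually_pos:
  assumes f: "stable_poly E N f"
  obtains T where "\<And>t. t \<ge> T \<Longrightarrow> rval f (\<lambda>e. x e + t * 1) > 0"
proof -
  obtain p where p: "\<And>t. f (\<lambda>e. cvec x e + t * cvec (\<lambda>e. 1) e) = cpoly p t"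
    and rp: "\<And>t. rval f (\<lambda>e. x e + t * 1) = poly p t"
    using affine_poly_line[OF stable_polyD(1)[OF f], of x "\<lambda>e. 1"] by blast
  obtain q where q: "degree q \<le> N" "coeff q N = 1" "\<And>t. f (\<lambda>e. cvec x e + t) = poly q t"
    using stable_polyD(2)[OF f, of "cvec x"] by blast
  have "poly (map_poly complex_of_real p) t = poly q t" for t
    using p[of t] q(3)[of t] by (simp add: cvec_def)
  then have "map_poly complex_of_real p = q" by (intro poly_eqI_degree_lead_coeff
      poly_eq_poly_eq_iff[THEN iffD1] ext)
  then have "degree p \<le> N" "coeff p N = 1"
    using q(1,2) by (auto simp: coeff_map_poly)
  then have "lead_coeff p = 1"
    using le_degree[of p N] by (metis le_antisym zero_neq_one)
  then obtain T where "\<forall>t\<ge>T. poly p t \<ge> lead_coeff p"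
    using poly_pinfty_gt_lc[of p] by auto
  then have "poly p t > 0" if "t \<ge> T" for t
    using that \<open>lead_coeff p = 1\<close> by force
  then show ?thesis using that[of T] rp by simp
qed

text \<open>A zero of \<open>f\<close> above \<open>x\<close> would force some
    \<open>\<partial>\<^sub>e f / f\<close> to tend to \<open>-\<infinity>\<close> at the largest zero
        on the
  diagonal ray, contradicting its monotonicity there.\<close>

lemma above_zeros_diff_op_imp:
  assumes f: "stable_poly E N f" and S: "finite S" "S \<subseteq> E"
    and ab: "above_zeros (diff_op 1 S f) x"
  shows "above_zeros f x"
  unfolding above_zeros_def
proof (intro allI impI, rule ccontr)
  fix y assume y: "\<forall>e. x e \<le> y e" and "\<not> rval f y > 0"
  note af = stable_polyD(1)[OF f]
  obtain a where a: "\<And>t. rval f (\<lambda>e. y e + t * 1) = poly a t"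
    using affine_poly_line[OF af, of y "\<lambda>e. 1"] by blast
  obtain T where T: "\<And>t. t \<ge> T \<Longrightarrow> rval f (\<lambda>e. y e + t * 1) > 0"
    using stable_poly_eventually_pos[OF f] by blast
  have T: "poly a t > 0" if "t \<ge> T" for t using T[OF that] unfolding a .
  define Z where "Z = {0..T} \<inter> {t. poly a t \<le> 0}"
  have a0: "poly a 0 \<le> 0" using \<open>\<not> rval f y > 0\<close> a[of 0] by simp
  have "compact Z"
    unfolding Z_def by (intro compact_Int_closed compact_Icc closed_Collect_le continuous_intros)
  moreover have "0 \<in> Z" using a0 T[of 0] by (auto simp: Z_def not_le intro: ccontr)
  ultimately obtain \<alpha> where \<alpha>: "\<alpha> \<in> Z" "\<And>t. t \<in> Z \<Longrightarrow> t
      \<le> \<alpha>"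
    using compact_attains_sup[of Z] by blast
  have \<alpha>0: "\<alpha> \<ge> 0" "poly a \<alpha> \<le> 0" using \<alpha>(1) by (auto simp: Z_def)
  have pos: "poly a t > 0" if "t > \<alpha>" for t
  proof (rule ccontr)
    assume "\<not> poly a t > 0"
    then have "t \<in> Z" using T[of t] that \<alpha>0 by (auto simp: Z_def not_less intro: le_cases[of
        t T])
    then show False using \<alpha>(2)[of t] that by simp
  qed
  have right: "at_right \<alpha> \<noteq> bot" by simp
  have lim: "(poly p \<longlongrightarrow> poly p \<alpha>) (at_right \<alpha>)" for p :: "real poly"
    by (intro tendsto_intros)
  have ev: "eventually (\<lambda>t. t > \<alpha> \<and> t < \<alpha> + 1) (at_right \<alpha>)"
    by (simp add: eventually_at_right[of \<alpha> "\<alpha> + 1"]) (auto intro: exI[of _ "\<alpha> + 1"])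
  have "poly a \<alpha> \<ge> 0"
    by (rule tendsto_lowerbound[OF lim _ right]) (use ev pos in \<open>auto elim!: eventually_mono
        intro: less_imp_le\<close>)
  then have a\<alpha>: "poly a \<alpha> = 0" using \<alpha>0 by simp
  have "rval (diff_op 1 S f) (\<lambda>e. y e + \<alpha> * 1) > 0"
    using y \<alpha>0 by (intro above_zerosD[OF ab]) (auto intro: add_increasing2)
  then have "(\<Sum>e\<in>S. rval (pd e f) (\<lambda>e. y e + \<alpha> * 1)) < 0"
    unfolding rval_diff_op a a\<alpha> by simp
  then obtain e where e: "e \<in> S" and neg: "rval (pd e f) (\<lambda>e. y e + \<alpha> * 1) < 0"
    by (meson sum_nonneg not_less)
  obtain b where b: "\<And>t. rval (pd e f) (\<lambda>e. y e + t * 1) = poly b t"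
    using affine_poly_line[OF affine_poly_pd[OF af], of e y "\<lambda>e. 1"] by blast
  \<comment> \<open>By monotonicity K bounds b / a from below between \<alpha> and \<alpha> + 1.
    Multiplying by a before passing to \<alpha> avoids an infinite limit: there K a vanishes while b
    is negative.\<close>
  define K where "K = poly b (\<alpha> + 1) / poly a (\<alpha> + 1)"
  have "K * poly a t \<le> poly b t" if "\<alpha> < t" "t < \<alpha> + 1" for t
  proof -
    have "poly a u \<noteq> 0" if "t \<le> u" for u using pos[of u] that \<open>\<alpha> < t\<close> by simp
    then have "K \<le> poly b t / poly a t"
      using stable_poly_pd_quotient_antimono[OF f, of e "\<lambda>e. 1" t "\<alpha> + 1" y] e S that
      unfolding a b K_def by auto
    then show ?thesis using pos[OF that(1)] by (simp add: pos_le_divide_eq)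
  qed
  then have "K * poly a \<alpha> \<le> poly b \<alpha>"
    by (intro tendsto_le[OF right lim tendsto_mult[OF tendsto_const lim]])
      (use ev in \<open>auto elim!: eventually_mono\<close>)
  then show False using neg a\<alpha> b by simp
qed

section \<open>Choosing one class per vector\<close>

lemma diff_op_selection:
  assumes f: "stable_poly E N f" and S: "finite S" "S \<subseteq> E" "S \<noteq> {}"
    and ab: "above_zeros (diff_op 1 S f) x"
  shows "\<exists>e\<in>S. above_zeros (diff_op (card S) {e} f) x"
proof -
  \<comment> \<open>Positivity of f itself above x makes the quotient \<open>pd e f\<close> / f
    monotone there, so that its bound 1 / \<open>card S\<close> at x propagates to all points
    above.\<close>
  note abf = above_zeros_diff_op_imp[OF f S(1,2) ab]
  have r: "real (card S) > 0" using S by (simp add: card_gt_0_iff)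
  have "rval (diff_op 1 S f) x > 0" by (rule above_zerosD[OF ab]) simp
  then have "0 < real (card S) * (rval f x - (\<Sum>e\<in>S. rval (pd e f) x))"
    using r by (simp add: rval_diff_op)
  also have "\<dots> = (\<Sum>e\<in>S. rval f x - real (card S) * rval (pd e f) x)"
    by (simp add: sum_subtractf sum_distrib_left right_diff_distrib)
  finally obtain e where e: "e \<in> S" "0 < rval f x - real (card S) * rval (pd e f) x"
    by (meson sum_nonpos not_less)
  have fx: "rval f x > 0" by (rule above_zerosD[OF abf]) simp
  have "above_zeros (diff_op (card S) {e} f) x"
    unfolding above_zeros_def
  proof (intro allI impI)
    fix y assume y: "\<forall>e. x e \<le> y e"
    have fy: "rval f y > 0" using above_zerosD[OF abf] y by blast
    have "rval (pd e f) y / rval f y \<le> rval (pd e f) x / rval f x"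
      using above_zeros_pd_quotient_antimono[OF f _ abf, of e y] e S y by auto
    also have "\<dots> < 1 / real (card S)"
      using e(2) fx r by (simp add: pos_divide_less_eq pos_less_divide_eq mult.commute)
    finally have "real (card S) * rval (pd e f) y < rval f y"
      using fy r by (simp add: pos_divide_less_eq pos_less_divide_eq mult.commute)
    then show "rval (diff_op (card S) {e} f) y > 0" by (simp add: rval_diff_op)
  qed
  then show ?thesis using e by blast
qed

lemma stable_poly_foldr_diff_op:
  assumes "stable_poly E N f" "\<forall>S\<in>set Ss. finite S \<and> S \<subseteq> E"
  shows "stable_poly E N (foldr (diff_op 1) Ss f)"
  using assms(2) by (induction Ss) (auto intro: stable_poly_diff_op assms(1))

lemma foldr_diff_op_commute:
  "foldr (diff_op c) Ss (diff_op d T f) = diff_op d T (foldr (diff_op c) Ss f)"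
  by (induction Ss) (simp_all add: diff_op_commute[of d T])

text \<open>The bound on the quotients is the induction invariant: at the moved point every barrier
  is at most its initial value at x, so a condition checked once at x serves all sets in the
  list.\<close>

lemma barrier_foldr:
  assumes f: "stable_poly E N f" and d: "d > 0" and ab: "above_zeros f x"
    and Ss: "\<forall>S\<in>set Ss. finite S \<and> S \<subseteq> E \<and> (\<Sum>e\<in>S. rval (pd e
        f) x / rval f x) \<le> 1 - 1 / d"
  defines "x' \<equiv> \<lambda>e. x e + d * (\<Sum>S\<leftarrow>Ss. of_bool (e \<in> S))"
  shows "above_zeros (foldr (diff_op 1) Ss f) x' \<and>
    (\<forall>e\<in>E. rval (pd e (foldr (diff_op 1) Ss f)) x' / rval (foldr (diff_op 1) Ss f) x'
      \<le> rval (pd e f) x / rval f x)"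
  using Ss unfolding x'_def
proof (induction Ss)
  case (Cons S Ss)
  define F where "F = foldr (diff_op 1) Ss f"
  define y where "y = (\<lambda>e. x e + d * (\<Sum>S\<leftarrow>Ss. of_bool (e \<in> S)))"
  have F: "stable_poly E N F"
    unfolding F_def by (rule stable_poly_foldr_diff_op[OF f]) (use Cons.prems in auto)
  have IH: "above_zeros F y" "\<And>e. e \<in> E \<Longrightarrow> rval (pd e F) y / rval F y \<le>
      rval (pd e f) x / rval f x"
    using Cons unfolding F_def y_def by auto
  have S: "finite S" "S \<subseteq> E" "(\<Sum>e\<in>S. rval (pd e f) x / rval f x) \<le> 1 - 1 / d"
    using Cons.prems by auto
  have "(\<Sum>e\<in>S. rval (pd e F) y / rval F y) \<le> (\<Sum>e\<in>S. rval (pd e f) x / rval f x)"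
    using S IH(2) by (intro sum_mono) auto
  then have le: "(\<Sum>e\<in>S. rval (pd e F) y / rval F y) \<le> 1 - 1 / d" using S(3) by linarith
  have x': "(\<lambda>e. x e + d * (\<Sum>S\<leftarrow>S # Ss. of_bool (e \<in> S))) = (\<lambda>e. y e
      + d * of_bool (e \<in> S))"
    by (simp add: y_def fun_eq_iff algebra_simps)
  have Fc: "foldr (diff_op 1) (S # Ss) f = diff_op 1 S F" by (simp add: F_def)
  show ?case
    unfolding x' Fc
    using barrier_step[OF F S(1,2) d IH(1) le] IH(2) by (intro conjI ballI) (assumption | rule order_trans)+
qed (use ab in simp)

text \<open>Once e is chosen for the first set, its operator commutes past the others and is
  absorbed into f; hence the induction over arbitrary f.\<close>

lemma selection_foldr:
  assumes "stable_poly E N f" "\<forall>S\<in>set Ss. finite S \<and> S \<subseteq> E \<and> S \<noteq>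
      {} \<and> card S = r"
    and "above_zeros (foldr (diff_op 1) Ss f) x"
  shows "\<exists>es. list_all2 (\<in>) es Ss \<and> above_zeros (foldr (\<lambda>e. diff_op r {e}) es f) x"
  using assms
proof (induction Ss arbitrary: f)
  case (Cons S Ss)
  have g: "stable_poly E N (foldr (diff_op 1) Ss f)"
    by (rule stable_poly_foldr_diff_op) (use Cons.prems in auto)
  have S: "finite S" "S \<subseteq> E" "S \<noteq> {}" "card S = r" using Cons.prems by auto
  have "above_zeros (diff_op 1 S (foldr (diff_op 1) Ss f)) x" using Cons.prems(3) by simp
  from diff_op_selection[OF g S(1-3) this]
  obtain e where e: "e \<in> S" "above_zeros (diff_op r {e} (foldr (diff_op 1) Ss f)) x"
    using S(4) by blast
  have "stable_poly E N (diff_op r {e} f)"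
    using e(1) S by (intro stable_poly_diff_op Cons.prems(1)) auto
  from Cons.IH[OF this] Cons.prems(2) e(2)
  obtain es where es: "list_all2 (\<in>) es Ss" "above_zeros (foldr (\<lambda>e. diff_op r {e}) es
      (diff_op r {e} f)) x"
    by (auto simp: foldr_diff_op_commute)
  have "foldr (\<lambda>e. diff_op r {e}) es (diff_op r {e} f) = foldr (\<lambda>e. diff_op r {e}) (e #
      es) f"
    by (induction es) (simp_all add: diff_op_commute[of r "{e}"])
  with e es show ?case by (intro exI[of _ "e # es"]) simp
qed simp

lemma foldr_diff_op_singleton:
  assumes "affine_poly E f" "distinct es" "set es \<subseteq> E"
  shows "foldr (\<lambda>e. diff_op r {e}) es f z = f (\<lambda>e. z e - of_real r * of_bool (e \<in>
      set es))"
  using assms(2,3)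
proof (induction es arbitrary: z)
  case (Cons e es)
  define g where "g = foldr (\<lambda>e. diff_op r {e}) es f"
  have "affine_poly E g"
    unfolding g_def by (induction es) (simp_all add: assms(1) affine_poly_diff_op)
  then have "diff_op r {e} g z = g (z(e := z e + - of_real r))"
    using Cons.prems by (subst affine_poly_upd) (auto simp: diff_op_def)
  also have "\<dots> = f (\<lambda>e'. (z(e := z e + - of_real r)) e' - of_real r * of_bool (e' \<in>
      set es))"
    unfolding g_def using Cons by simp
  also have "(\<lambda>e'. (z(e := z e + - of_real r)) e' - of_real r * of_bool (e' \<in> set es))
      = (\<lambda>e'. z e' - of_real r * of_bool (e' \<in> set (e # es)))"
    using Cons.prems by auto
  finally show ?case by (simp add: g_def)
qed simp

text \<open>By \<open>disj\<close> a coordinate lies in at most one set of the list and is raised by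
  at most d in total, so the constant point t + d is above the final one. For distinct choices the
  composed singleton operators are one simultaneous shift.\<close>

theorem stable_poly_selection:
  assumes f: "stable_poly E N f" and d: "d > 0" and ab: "above_zeros f (\<lambda>_. t)"
    and Ss: "\<forall>S\<in>set Ss. finite S \<and> S \<subseteq> E \<and> S \<noteq> {} \<and> card S
        = r \<and>
      (\<Sum>e\<in>S. rval (pd e f) (\<lambda>_. t) / rval f (\<lambda>_. t)) \<le> 1 - 1 / d"
    and disj: "\<And>e. (\<Sum>S\<leftarrow>Ss. of_bool (e \<in> S)) \<le> (1 :: real)"
  shows "\<exists>es. list_all2 (\<in>) es Ss \<and> (distinct es \<longrightarrow>
    above_zeros (\<lambda>z. f (\<lambda>e. z e - of_nat r * of_bool (e \<in> set es))) (\<lambda>_. t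
        + d))"
proof -
  have "above_zeros (foldr (diff_op 1) Ss f) (\<lambda>e. t + d * (\<Sum>S\<leftarrow>Ss. of_bool (e
      \<in> S)))"
    using barrier_foldr[OF f d ab, of Ss] Ss by blast
  then have "above_zeros (foldr (diff_op 1) Ss f) (\<lambda>_. t + d)"
    by (rule above_zeros_mono) (use d disj in \<open>simp add: mult_left_le\<close>)
  from selection_foldr[OF f _ this] Ss
  obtain es where es: "list_all2 (\<in>) es Ss" "above_zeros (foldr (\<lambda>e. diff_op r {e}) es f)
      (\<lambda>_. t + d)"
    by blast
  have "set es \<subseteq> E"
    using es(1) Ss by (induction rule: list_all2_induct) auto
  then have eq: "foldr (\<lambda>e. diff_op r {e}) es f = (\<lambda>z. f (\<lambda>e. z e - of_nat r *
      of_bool (e \<in> set es)))"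
    if "distinct es"
    using foldr_diff_op_singleton[OF stable_polyD(1)[OF f] that, of r] by auto
  show ?thesis
  proof (intro exI[of _ es] conjI impI)
    assume "distinct es"
    from es(2) show "above_zeros (\<lambda>z. f (\<lambda>e. z e - of_nat r * of_bool (e \<in> set
        es))) (\<lambda>_. t + d)"
      unfolding eq[OF \<open>distinct es\<close>] .
  qed (fact es(1))
qed

section \<open>Determinantal pencils of Hermitian contractions\<close>

text \<open>Besides Hermitian symmetry this says that G^2 <= G as quadratic forms, i.e. 0 <= G <= 1.
  With p = G v the condition is |p|^2 <= <v, p>, the form in which it meets the kernel equation and
  the Bessel bound.\<close>

definition hermitian_contraction :: "nat \<Rightarrow> (nat \<Rightarrow> nat \<Rightarrow> complex)
    \<Rightarrow> bool"
  where "hermitian_contraction n G \<longleftrightarrow> (\<forall>i j. G j i = cnj (G i j)) \<and>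
    (\<forall>v. let p = (\<lambda>i. \<Sum>j<n. G i j * v j) in
      Im (\<Sum>i<n. v i * cnj (p i)) = 0 \<and> (\<Sum>i<n. (cmod (p i))\<^sup>2) \<le> Re (\<Sum>i<n.
          v i * cnj (p i)))"

lemma hermitian_contraction_cnj: "hermitian_contraction n G \<Longrightarrow> G j i = cnj (G i j)"
  unfolding hermitian_contraction_def by blast

text \<open>\<open>x 1 + diag (z\<^sub>i - x) G\<close>. For the Gram matrix \<open>G\<close> of
    vectors \<open>u\<^sub>i\<close> its determinant is, up to a power of
  \<open>x\<close>, that of \<open>x (1 - \<Sum> u\<^sub>i u\<^sub>i\<^sup>*) + \<Sum> z\<^sub>i
      u\<^sub>i u\<^sub>i\<^sup>*\<close>.\<close>

definition pencil :: "nat \<Rightarrow> (nat \<Rightarrow> nat \<Rightarrow> complex) \<Rightarrow>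
    complex \<Rightarrow> (nat \<Rightarrow> complex) \<Rightarrow> complex mat"
  where "pencil n G x z = Matrix.mat n n (\<lambda>(i, j). (if i = j then x else 0) + (z i - x) * G i j)"

definition pencil_det :: "nat \<Rightarrow> (nat \<Rightarrow> nat \<Rightarrow> complex) \<Rightarrow>
    complex \<Rightarrow> (nat \<Rightarrow> complex) \<Rightarrow> complex"
  where "pencil_det n G x z = Determinant.det (pencil n G x z)"

lemma pencil_carrier [simp]: "pencil n G x z \<in> carrier_mat n n"
  by (simp add: pencil_def)

lemma pencil_dim [simp]: "dim_row (pencil n G x z) = n" "dim_col (pencil n G x z) = n"
  by (simp_all add: pencil_def)

lemma pencil_index: "i < n \<Longrightarrow> j < n \<Longrightarrow> pencil n G x z $$ (i, j) = (if i =
    j then x else 0) + (z i - x) * G i j"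
  by (simp add: pencil_def)

lemma pencil_mult_vec:
  assumes "v \<in> carrier_vec n" "i < n"
  shows "Matrix.vec_index (pencil n G x z *\<^sub>v v) i =
    x * Matrix.vec_index v i + (z i - x) * (\<Sum>j<n. G i j * Matrix.vec_index v j)"
proof -
  have "Matrix.vec_index (pencil n G x z *\<^sub>v v) i
      = (\<Sum>j<n. ((if i = j then x else 0) + (z i - x) * G i j) * Matrix.vec_index v j)"
    using assms by (simp add: scalar_prod_def pencil_def atLeast0LessThan)
  also have "\<dots> = (\<Sum>j<n. (if i = j then x * Matrix.vec_index v j else 0)) + (\<Sum>j<n. (z i
      - x) * (G i j * Matrix.vec_index v j))"
    unfolding sum.distrib[symmetric] by (intro sum.cong) (auto simp: algebra_simps)
  finally show ?thesis using assms by (simp add: sum_distrib_left)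
qed

text \<open>With \<open>p = G v\<close>, pairing the kernel equation with \<open>p\<close> gives
  \<open>x (v \<bullet> p - p \<bullet> p) + \<Sum> z\<^sub>i \<bar>p\<^sub>i\<bar>\<^sup>2 =
      0\<close>, where \<open>v \<bullet> p \<ge> p \<bullet> p\<close>.\<close>

lemma pencil_det_nonzero:
  assumes G: "hermitian_contraction n G"
    and x: "Re (\<omega> * x) > 0" and z: "\<And>i. i < n \<Longrightarrow> Re (\<omega> * z i) > 0"
  shows "pencil_det n G x z \<noteq> 0"
proof
  assume "pencil_det n G x z = 0"
  then obtain v where v: "v \<in> carrier_vec n" "v \<noteq> 0\<^sub>v n" "pencil n G x z *\<^sub>v v =
      0\<^sub>v n"
    unfolding pencil_det_def using det_0_iff_vec_prod_zero_field[OF pencil_carrier] by blast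
  define w where "w i = Matrix.vec_index v i" for i
  define p where "p i = (\<Sum>j<n. G i j * w j)" for i
  define Q where "Q = (\<Sum>i<n. w i * cnj (p i))"
  have Q: "Im Q = 0" "(\<Sum>i<n. (cmod (p i))\<^sup>2) \<le> Re Q"
  proof -
    have "let p = (\<lambda>i. \<Sum>j<n. G i j * w j) in
      Im (\<Sum>i<n. w i * cnj (p i)) = 0 \<and> (\<Sum>i<n. (cmod (p i))\<^sup>2) \<le> Re (\<Sum>i<n.
          w i * cnj (p i))"
      using G unfolding hermitian_contraction_def by blast
    then show "Im Q = 0" "(\<Sum>i<n. (cmod (p i))\<^sup>2) \<le> Re Q"
      unfolding Q_def p_def by (simp_all only: Let_def)
  qed
  have ker: "x * w i + (z i - x) * p i = 0" if "i < n" for i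
    using pencil_mult_vec[OF v(1) that, of G x z] that unfolding v(3) p_def w_def by simp
  have expand: "(x * a + (b - x) * c) * d = x * (a * d) - x * (c * d) + b * (c * d)" for a b c d :: complex
    by (simp add: algebra_simps)
  have "0 = (\<Sum>i<n. (x * w i + (z i - x) * p i) * cnj (p i))" using ker by simp
  also have "\<dots> = (\<Sum>i<n. x * (w i * cnj (p i)) - x * of_real ((cmod (p i))\<^sup>2) + z i *
      of_real ((cmod (p i))\<^sup>2))"
    unfolding complex_norm_square by (intro sum.cong refl expand)
  also have "\<dots> = x * Q - x * of_real (\<Sum>i<n. (cmod (p i))\<^sup>2) + (\<Sum>i<n. z i *
      of_real ((cmod (p i))\<^sup>2))"
    by (simp add: sum.distrib sum_subtractf Q_def sum_distrib_left)
  also have "Q = of_real (Re Q)" using Q(1) by (simp add: complex_eq_iff)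
  finally have 0: "0 = x * of_real (Re Q) - x * of_real (\<Sum>i<n. (cmod (p i))\<^sup>2) + (\<Sum>i<n.
      z i * of_real ((cmod (p i))\<^sup>2))" .
  \<comment> \<open>Rotation by \<omega> moves x and all z_i into the open right half plane, where a
    vanishing combination with nonnegative weights has all weights zero. The value - i serves
    stability, the value 1 positivity at real points.\<close>
  have "0 = \<omega> * (x * of_real (Re Q) - x * of_real (\<Sum>i<n. (cmod (p i))\<^sup>2) +
      (\<Sum>i<n. z i * of_real ((cmod (p i))\<^sup>2)))"
    unfolding 0[symmetric] by simp
  also have "\<dots> = of_real (Re Q - (\<Sum>i<n. (cmod (p i))\<^sup>2)) * (\<omega> * x) +
      (\<Sum>i<n. of_real ((cmod (p i))\<^sup>2) * (\<omega> * z i))"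
    by (simp add: algebra_simps sum_distrib_left)
  finally have 0: "0 = of_real (Re Q - (\<Sum>i<n. (cmod (p i))\<^sup>2)) * (\<omega> * x) +
      (\<Sum>i<n. of_real ((cmod (p i))\<^sup>2) * (\<omega> * z i))" .
  have "0 = Re (of_real (Re Q - (\<Sum>i<n. (cmod (p i))\<^sup>2)) * (\<omega> * x) + (\<Sum>i<n.
      of_real ((cmod (p i))\<^sup>2) * (\<omega> * z i)))"
    unfolding 0[symmetric] by simp
  also have "\<dots> = (Re Q - (\<Sum>i<n. (cmod (p i))\<^sup>2)) * Re (\<omega> * x) + (\<Sum>i<n.
      (cmod (p i))\<^sup>2 * Re (\<omega> * z i))"
    by (simp only: plus_complex.sel Re_sum Re_complex_of_real Im_complex_of_real
        times_complex.sel(1)[of "complex_of_real _"] mult_zero_left diff_0_right)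
  finally have "0 = (Re Q - (\<Sum>i<n. (cmod (p i))\<^sup>2)) * Re (\<omega> * x) + (\<Sum>i<n. (cmod
      (p i))\<^sup>2 * Re (\<omega> * z i))" .
  moreover have "(Re Q - (\<Sum>i<n. (cmod (p i))\<^sup>2)) * Re (\<omega> * x) \<ge> 0" using Q(2) x
      by simp
  moreover have nn: "(cmod (p i))\<^sup>2 * Re (\<omega> * z i) \<ge> 0" if "i < n" for i
    using z[OF that] by (intro mult_nonneg_nonneg) auto
  then have "(\<Sum>i<n. (cmod (p i))\<^sup>2 * Re (\<omega> * z i)) \<ge> 0" by (intro sum_nonneg) auto
  ultimately have "(\<Sum>i<n. (cmod (p i))\<^sup>2 * Re (\<omega> * z i)) = 0" by linarith
  then have "\<forall>i\<in>{..<n}. (cmod (p i))\<^sup>2 * Re (\<omega> * z i) = 0"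
    using nn by (subst (asm) sum_nonneg_eq_0_iff) auto
  then have p0: "p i = 0" if "i < n" for i using z[OF that] that by force
  have "x \<noteq> 0" using x by auto
  then have "w i = 0" if "i < n" for i using ker[OF that] p0[OF that] by simp
  then have "v = 0\<^sub>v n" using v(1) by (intro eq_vecI) (auto simp: w_def)
  then show False using v(2) by simp
qed

text \<open>The variable z_i occurs only in row i, which the cofactors along that row
  delete.\<close>

lemma pencil_det_expand:
  assumes "i < n"
  shows "pencil_det n G x (z(i := t)) = (\<Sum>j<n. ((if i = j then x else 0) + (t - x) * G i j) *
      cofactor (pencil n G x z) i j)"
proof -
  have "mat_delete (pencil n G x (z(i := t))) i j = mat_delete (pencil n G x z) i j" for j
    by (rule eq_matI) (auto simp: mat_delete_def pencil_def)
  then have "cofactor (pencil n G x (z(i := t))) i j = cofactor (pencil n G x z) i j" for j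
    by (simp add: cofactor_def)
  then show ?thesis
    using laplace_expansion_row[OF pencil_carrier \<open>i < n\<close>, of G x "z(i := t)"] assms
    by (simp add: pencil_det_def pencil_index)
qed

lemma pencil_det_affine:
  "pencil_det n G x (z(i := t)) = pencil_det n G x (z(i := 0))
    + t * (pencil_det n G x (z(i := 1)) - pencil_det n G x (z(i := 0)))"
proof (cases "i < n")
  case True
  have "t * (pencil_det n G x (z(i := 1)) - pencil_det n G x (z(i := 0))) = (\<Sum>j<n. t * G i j *
      cofactor (pencil n G x z) i j)"
    unfolding pencil_det_expand[OF True] sum_subtractf[symmetric] sum_distrib_left
    by (intro sum.cong) (auto simp: algebra_simps)
  then show ?thesis
    unfolding pencil_det_expand[OF True] sum.distrib[symmetric]
    by (simp only: pencil_det_expand[OF True] sum.distrib[symmetric]) (intro sum.cong refl, simp add: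
        algebra_simps)
next
  case False
  then have "pencil n G x (z(i := t)) = pencil n G x z" for t
    by (intro eq_matI) (auto simp: pencil_def)
  then show ?thesis by (simp add: pencil_det_def)
qed

lemma pencil_det_line:
  "\<exists>p. \<forall>t. pencil_det n G (x + t * a) (\<lambda>i. z i + t * b i) = poly p t"
proof -
  define A where "A = Matrix.mat n n (\<lambda>(i, j). (if i = j then [:x, a:] else 0) + ([:z i, b i:]
      - [:x, a:]) * [:G i j:])"
  have "pencil_det n G (x + t * a) (\<lambda>i. z i + t * b i) = poly (Determinant.det A) t" for t
  proof -
    have "map_mat (\<lambda>p. poly p t) A = pencil n G (x + t * a) (\<lambda>i. z i + t * b i)"
      by (rule eq_matI) (auto simp: A_def pencil_def algebra_simps)
    then show ?thesis by (simp add: pencil_det_def flip: comm_ring_hom.hom_det[OF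
        poly_hom.comm_ring_hom_axioms])
  qed
  then show ?thesis by blast
qed

text \<open>A common shift leaves every z_i - x unchanged and adds t 1 to the pencil, so the
  determinant is the characteristic polynomial of the negated pencil.\<close>

lemma pencil_det_diagonal_line:
  "\<exists>p. degree p = n \<and> lead_coeff p = 1 \<and> (\<forall>t. pencil_det n G (x + t)
      (\<lambda>i. z i + t) = poly p t)"
proof -
  let ?M = "- pencil n G x z"
  have M: "?M \<in> carrier_mat n n" by simp
  have "- char_matrix ?M t = pencil n G (x + t) (\<lambda>i. z i + t)" for t
    by (rule eq_matI) (auto simp: char_matrix_def pencil_def)
  then have "pencil_det n G (x + t) (\<lambda>i. z i + t) = poly (char_poly ?M) t" for t
    by (simp add: pencil_det_def char_poly_matrix[OF M])
  then show ?thesis using degree_monic_char_poly[OF M] by metis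
qed

text \<open>With Y = diag(z_i - x) one has (x + Y G) Y = Y (x + G Y), and the last bracket is the
  transpose of the pencil of the transposed matrix. Invertibility of Y lets its determinant
  cancel.\<close>

lemma pencil_det_transpose:
  assumes "\<And>i. i < n \<Longrightarrow> z i \<noteq> x"
  shows "pencil_det n (\<lambda>i j. G j i) x z = pencil_det n G x z"
proof -
  define Y where "Y = Matrix.mat n n (\<lambda>(i, j). if i = j then z i - x else 0)"
  have Y: "Y \<in> carrier_mat n n" by (simp add: Y_def)
  let ?B = "pencil n (\<lambda>i j. G j i) x z"
  have eq: "pencil n G x z * Y = Y * transpose_mat ?B"
  proof (rule eq_matI)
    fix i j assume "i < dim_row (Y * transpose_mat ?B)" "j < dim_col (Y * transpose_mat ?B)"
    then have ij: "i < n" "j < n" by (auto simp: Y_def pencil_def)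
    have "(pencil n G x z * Y) $$ (i, j) = (\<Sum>k<n. pencil n G x z $$ (i, k) * (if k = j then z k -
        x else 0))"
      using ij by (simp add: Y_def scalar_prod_def atLeast0LessThan)
    also have "\<dots> = (\<Sum>k<n. if k = j then pencil n G x z $$ (i, j) * (z j - x) else 0)"
      by (intro sum.cong) auto
    also have "\<dots> = pencil n G x z $$ (i, j) * (z j - x)" using ij by simp
    also have "\<dots> = (z i - x) * ?B $$ (j, i)" using ij by (auto simp: pencil_index algebra_simps)
    also have "\<dots> = (\<Sum>k<n. if k = i then (z i - x) * ?B $$ (j, i) else 0)" using ij by simp
    also have "\<dots> = (\<Sum>k<n. (if i = k then z i - x else 0) * ?B $$ (j, k))"
      by (intro sum.cong) auto
    also have "\<dots> = (Y * transpose_mat ?B) $$ (i, j)"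
      using ij by (simp add: Y_def scalar_prod_def atLeast0LessThan)
    finally show "(pencil n G x z * Y) $$ (i, j) = (Y * transpose_mat ?B) $$ (i, j)" .
  qed (auto simp: Y_def pencil_def)
  have "Determinant.det Y = (\<Prod>i<n. z i - x)"
    by (subst det_upper_triangular[OF _ Y]) (auto simp: Y_def upper_triangular_def prod_list_diag_prod
        atLeast0LessThan)
  then have "Determinant.det Y \<noteq> 0" using assms by auto
  moreover have "Determinant.det (pencil n G x z) * Determinant.det Y = Determinant.det Y *
      Determinant.det ?B"
    using arg_cong[OF eq, of Determinant.det] Y by (simp add: det_mult[of _ n] det_transpose[of _ n])
  ultimately show ?thesis by (simp add: pencil_det_def)
qed

text \<open>Conjugation replaces G by its transpose, which does not change the determinant when all
  z_i differ from x. The general case is the limit of z_i + t as t tends to 0.\<close>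

lemma pencil_det_real:
  assumes G: "\<And>i j. G j i = cnj (G i j)"
  shows "pencil_det n G (of_real x) (\<lambda>i. of_real (z i)) \<in> \<real>"
proof -
  have cnj: "cnj (pencil_det n G (of_real x) (\<lambda>i. of_real (z i))) = pencil_det n (\<lambda>i j.
      G j i) (of_real x) (\<lambda>i. of_real (z i))" for z
  proof -
    interpret comm_ring_hom cnj by unfold_locales auto
    have "map_mat cnj (pencil n G (of_real x) (\<lambda>i. of_real (z i))) = pencil n (\<lambda>i j. G
        j i) (of_real x) (\<lambda>i. of_real (z i))"
      by (rule eq_matI) (auto simp: pencil_def G[symmetric])
    then show ?thesis unfolding pencil_det_def by (simp flip: hom_det)
  qed
  have generic: "pencil_det n G (of_real x) (\<lambda>i. of_real (z i)) \<in> \<real>" if "\<And>i. i <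
      n \<Longrightarrow> z i \<noteq> x" for z
    using pencil_det_transpose[of n "\<lambda>i. of_real (z i)" "of_real x" G] that cnj[of z]
    by (simp add: Reals_cnj_iff)
  obtain p where p: "\<And>t. pencil_det n G (of_real x + t * 0) (\<lambda>i. of_real (z i) + t * 1) =
      poly p t"
    using pencil_det_line[of n G "of_real x" 0 "\<lambda>i. of_real (z i)" "\<lambda>_. 1"] by blast
  have "poly p (of_real 0) \<in> \<real>"
  proof (rule Lim_in_closed_set[OF closed_complex_Reals])
    show "((\<lambda>t::real. poly p (of_real t)) \<longlongrightarrow> poly p (of_real 0)) (at 0)" by
        (intro tendsto_intros)
    have "eventually (\<lambda>t::real. \<forall>i\<in>{..<n}. t \<noteq> x - z i) (at 0)"
      by (intro eventually_ball_finite ballI eventually_neq_at_within) auto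
    then show "eventually (\<lambda>t::real. poly p (of_real t) \<in> \<real>) (at 0)"
    proof eventually_elim
      case (elim t)
      then have "pencil_det n G (of_real x) (\<lambda>i. of_real (z i + t)) \<in> \<real>"
        by (intro generic) (auto simp: algebra_simps)
      then show ?case using p[of "of_real t"] by simp
    qed
  qed simp
  then show ?thesis using p[of 0] by simp
qed

text \<open>At x = z_i = t the pencil is t 1, and the adjugate gives its cofactors. The logarithmic
  derivative in z_i at this point is thus G_ii / t, the initial value of the barrier.\<close>

lemma pencil_det_const:
  assumes "t \<noteq> 0"
  shows "pencil_det n G t (\<lambda>_. t) = t ^ n"
    and "i < n \<Longrightarrow> pencil_det n G t ((\<lambda>_. t)(i := t + s)) = t ^ n + s * G i i *
        (t ^ n / t)"
proof -
  have P: "pencil n G t (\<lambda>_. t) = t \<cdot>\<^sub>m 1\<^sub>m n" by (rule eq_matI) (auto simp: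
      pencil_def)
  show d: "pencil_det n G t (\<lambda>_. t) = t ^ n" by (simp add: pencil_det_def P)
  assume i: "i < n"
  have "t \<cdot>\<^sub>m adj_mat (t \<cdot>\<^sub>m 1\<^sub>m n) = t ^ n \<cdot>\<^sub>m 1\<^sub>m n"
    using adj_mat(2)[of "t \<cdot>\<^sub>m 1\<^sub>m n" n] adj_mat(1)[of "t \<cdot>\<^sub>m 1\<^sub>m n" n]
      mult_smult_assoc_mat[of "1\<^sub>m n" n n "adj_mat (t \<cdot>\<^sub>m 1\<^sub>m n)" n t] by simp
  then have "(t \<cdot>\<^sub>m adj_mat (t \<cdot>\<^sub>m 1\<^sub>m n)) $$ (j, i) = (t ^ n
      \<cdot>\<^sub>m 1\<^sub>m n) $$ (j, i)" for j by simp
  then have cof: "cofactor (pencil n G t (\<lambda>_. t)) i j = (if i = j then t ^ n / t else 0)" if "j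
      < n" for j
    using that i assms
    by (auto simp: P adj_mat_def eq_divide_eq mult.commute[of _ t] dest!: meta_spec[of _ j] split:
        if_splits)
  have "pencil_det n G t ((\<lambda>_. t)(i := t + s)) = (\<Sum>j<n. if i = j then (t + s * G i i) * (t
      ^ n / t) else 0)"
    unfolding pencil_det_expand[OF i] by (intro sum.cong) (auto simp: cof)
  then show "pencil_det n G t ((\<lambda>_. t)(i := t + s)) = t ^ n + s * G i i * (t ^ n / t)"
    using i assms by (simp add: distrib_right)
qed

section \<open>The product polynomial and its threshold\<close>

lemma above_zerosI_nonzero:
  assumes f: "stable_poly E N f" and nz: "\<And>y. (\<And>e. x e \<le> y e) \<Longrightarrow> rval f y
      \<noteq> 0"
  shows "above_zeros f x"
  unfolding above_zeros_def
proof (intro allI impI, rule ccontr)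
  fix y assume y: "\<forall>e. x e \<le> y e" and "\<not> rval f y > 0"
  obtain a where a: "\<And>t. rval f (\<lambda>e. y e + t * 1) = poly a t"
    using affine_poly_line[OF stable_polyD(1)[OF f], of y "\<lambda>e. 1"] by blast
  obtain T where T: "\<And>t. t \<ge> T \<Longrightarrow> rval f (\<lambda>e. y e + t * 1) > 0"
    using stable_poly_eventually_pos[OF f] by blast
  have nza: "poly a t \<noteq> 0" if "t \<ge> 0" for t
    unfolding a[symmetric] using y that by (intro nz) (auto intro: add_increasing2)
  have "poly a 0 < 0" using nza[of 0] a[of 0] \<open>\<not> rval f y > 0\<close> by simp
  moreover have "poly a (max T 1) > 0" using T[of "max T 1"] unfolding a by simp
  moreover have "0 < max T 1" by (simp add: less_max_iff_disj)
  ultimately obtain t where "0 < t" "poly a t = 0"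
    using poly_IVT_pos[of 0 "max T 1" a] by blast
  then show False using nza[of t] by simp
qed

text \<open>Coordinate \<open>None\<close> is \<open>x\<close>, and \<open>Some (i, k)\<close> belongs
    to vector \<open>i\<close> put into class \<open>k\<close>.\<close>

definition pencil_prod :: "nat \<Rightarrow> (nat \<Rightarrow> nat \<Rightarrow> complex)
    \<Rightarrow> nat \<Rightarrow> ((nat \<times> nat) option \<Rightarrow> complex) \<Rightarrow> complex"
  where "pencil_prod n G r z = (\<Prod>k<r. pencil_det n G (z None) (\<lambda>i. z (Some (i, k))))"

lemma pencil_prod_upd:
  assumes "k < r"
  shows "pencil_prod n G r (z(Some (i, k) := t)) =
    pencil_det n G (z None) ((\<lambda>i. z (Some (i, k)))(i := t)) *
    (\<Prod>k\<in>{..<r} - {k}. pencil_det n G (z None) (\<lambda>i. z (Some (i, k))))"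
proof -
  have "(\<lambda>i'. (z(Some (i, k) := t)) (Some (i', k))) = (\<lambda>i. z (Some (i, k)))(i := t)" by auto
  then show ?thesis
    unfolding pencil_prod_def using assms by (subst prod.remove[of _ k]) auto
qed

lemma stable_poly_pencil_prod:
  assumes G: "hermitian_contraction n G"
  shows "stable_poly {Some (i, k) | i k. k < r} (n * r) (pencil_prod n G r)"
  unfolding stable_poly_def affine_poly_def
proof (intro conjI ballI allI impI)
  fix e z t assume "e \<in> {Some (i :: nat, k) | i k. k < r}"
  then obtain i k where e: "e = Some (i, k)" "k < r" by auto
  have alg: "(a + t * (b - a)) * R = a * R + t * (b * R - a * R)" for a b R :: complex
    by (simp add: algebra_simps)
  show "pencil_prod n G r (z(e := t)) = pencil_prod n G r (z(e := 0)) + t * pd e (pencil_prod n G r) z"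
    unfolding pd_def e(1) pencil_prod_upd[OF e(2)]
    by (subst pencil_det_affine[of n G "z None" "\<lambda>i. z (Some (i, k))" i t]) (rule alg)
next
  fix x
  show "pencil_prod n G r (cvec x) \<in> \<real>"
    unfolding pencil_prod_def cvec_def
    by (intro prod_in_Reals pencil_det_real hermitian_contraction_cnj[OF G])
next
  fix z w :: "(nat \<times> nat) option \<Rightarrow> complex"
  have "\<forall>k. \<exists>p. \<forall>t. pencil_det n G (z None + t * w None) (\<lambda>i. z (Some
      (i, k)) + t * w (Some (i, k))) = poly p t"
    by (intro allI pencil_det_line)
  then obtain p where p: "\<And>k t. pencil_det n G (z None + t * w None) (\<lambda>i. z (Some (i, k))
      + t * w (Some (i, k))) = poly (p k) t"
    by metis
  show "\<exists>p. \<forall>t. pencil_prod n G r (\<lambda>e. z e + t * w e) = poly p t"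
    by (intro exI[of _ "\<Prod>k<r. p k"]) (simp add: pencil_prod_def p poly_prod)
next
  fix z :: "(nat \<times> nat) option \<Rightarrow> complex"
  have "\<forall>k. \<exists>p. degree p = n \<and> lead_coeff p = 1 \<and> (\<forall>t. pencil_det n G
      (z None + t) (\<lambda>i. z (Some (i, k)) + t) = poly p t)"
    by (intro allI pencil_det_diagonal_line)
  then obtain p where p: "\<And>k. degree (p k) = n" "\<And>k. lead_coeff (p k) = 1"
    "\<And>k t. pencil_det n G (z None + t) (\<lambda>i. z (Some (i, k)) + t) = poly (p k) t"
    by metis
  define P where "P = (\<Prod>k<r. p k)"
  have "p k \<noteq> 0" for k using p(2)[of k] by auto
  then have "degree P = n * r" unfolding P_def by (subst degree_prod_eq_sum_degree) (auto simp: p(1))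
  moreover have "lead_coeff P = 1" unfolding P_def lead_coeff_prod by (simp add: p(2))
  moreover have "pencil_prod n G r (\<lambda>e. z e + t) = poly P t" for t
    by (simp add: pencil_prod_def P_def p(3) poly_prod)
  ultimately show "\<exists>p. degree p \<le> n * r \<and> coeff p (n * r) = 1 \<and> (\<forall>t.
      pencil_prod n G r (\<lambda>e. z e + t) = poly p t)"
    by (intro exI[of _ P]) auto
next
  fix z :: "(nat \<times> nat) option \<Rightarrow> complex" assume z: "\<forall>e. Im (z e) > 0"
  have "pencil_det n G (z None) (\<lambda>i. z (Some (i, k))) \<noteq> 0" for k
    \<comment> \<open>Re (- i z) = Im z.\<close>
    by (rule pencil_det_nonzero[OF G, of "- \<i>"]) (use z in auto)
  then show "pencil_prod n G r z \<noteq> 0" by (simp add: pencil_prod_def)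
qed

lemma rval_pencil_prod_const:
  assumes "t > 0"
  shows "pencil_prod n G r (cvec (\<lambda>_. t)) = of_real ((t ^ n) ^ r)"
    and "i < n \<Longrightarrow> k < r \<Longrightarrow> pd (Some (i, k)) (pencil_prod n G r) (cvec
        (\<lambda>_. t)) = of_real ((t ^ n) ^ r) * (G i i / of_real t)"
proof -
  have t: "complex_of_real t \<noteq> 0" using assms by simp
  show *: "pencil_prod n G r (cvec (\<lambda>_. t)) = of_real ((t ^ n) ^ r)"
    by (simp add: pencil_prod_def cvec_def pencil_det_const(1)[OF t])
  assume i: "i < n" and k: "k < r"
  define R where "R = (\<Prod>k\<in>{..<r} - {k}. pencil_det n G (of_real t) (\<lambda>i. of_real t))"
  have val: "pencil_prod n G r ((cvec (\<lambda>_. t))(Some (i, k) := s)) = pencil_det n G (of_real t)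
      ((\<lambda>_. of_real t)(i := s)) * R" for s
    unfolding pencil_prod_upd[OF k] R_def by (simp add: cvec_def)
  have e: "pencil_det n G (of_real t) ((\<lambda>_. of_real t)(i := s)) = of_real t ^ n + (s - of_real
      t) * G i i * (of_real t ^ n / of_real t)" for s
    using pencil_det_const(2)[OF t i, of G "s - of_real t"] by simp
  have alg: "(A + (1 - t) * g * u) * R - (A + (0 - t) * g * u) * R = g * u * R" for A g u t R :: complex
    by (simp add: algebra_simps)
  have "pd (Some (i, k)) (pencil_prod n G r) (cvec (\<lambda>_. t)) = G i i * (of_real t ^ n / of_real
      t) * R"
    unfolding pd_def val e by (rule alg)
  also have "\<dots> = (of_real t ^ n * R) * (G i i / of_real t)" by simp
  also have "of_real t ^ n * R = pencil_prod n G r (cvec (\<lambda>_. t))"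
    using val[of "of_real t"] e[of "of_real t"] by (simp add: cvec_def fun_upd_idem)
  also note *
  finally show "pd (Some (i, k)) (pencil_prod n G r) (cvec (\<lambda>_. t)) = of_real ((t ^ n) ^ r) *
      (G i i / of_real t)" .
qed

text \<open>At these arguments the pencil is x 1 - r diag(1_S) G with S the class of k, so the
  conclusion excludes eigenvalues of r times the Gram matrix of each class from the threshold
  on.\<close>

theorem pencil_det_selection:
  assumes G: "hermitian_contraction n G" and diag: "\<And>i. i < n \<Longrightarrow> Re (G i i) \<le>
      \<delta>"
    and \<delta>: "\<delta> > 0" and r: "r > 0"
  shows "\<exists>s. (\<forall>i<n. s i < r) \<and> (\<forall>x k. x \<ge> (1 + sqrt (r *
      \<delta>))\<^sup>2 \<longrightarrow> k < r \<longrightarrow>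
    pencil_det n G (of_real x) (\<lambda>i. of_real x - of_nat r * of_bool (s i = k)) \<noteq> 0)"
proof -
  let ?f = "pencil_prod n G r"
  let ?E = "{Some (i, k) | i k. k < r} :: (nat \<times> nat) option set"
  define q where "q = sqrt (r * \<delta>)"
  have q: "q > 0" "q\<^sup>2 = r * \<delta>" using \<delta> r by (simp_all add: q_def)
  \<comment> \<open>The barrier allows t and d with r \<delta> / t <= 1 - 1 / d and yields the
    threshold t + d. For r \<delta> = q^2 this is least at t = q + q^2 and d = 1 + q, where it
    equals (1 + q)^2.\<close>
  define t where "t = q + q\<^sup>2"
  have t: "t > 0" using q(1) by (simp add: t_def add_pos_pos)
  note f = stable_poly_pencil_prod[OF G, of r]
  have above: "above_zeros ?f (\<lambda>_. t)"
  proof (rule above_zerosI_nonzero[OF f])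
    fix y :: "(nat \<times> nat) option \<Rightarrow> real" assume y: "\<And>e. t \<le> y e"
    have ypos: "y e > 0" for e using y[of e] t by linarith
    have "pencil_det n G (cvec y None) (\<lambda>i. cvec y (Some (i, k))) \<noteq> 0" for k
      by (rule pencil_det_nonzero[OF G, of 1]) (use ypos in \<open>auto simp: cvec_def\<close>)
    then have "?f (cvec y) \<noteq> 0" by (simp add: pencil_prod_def)
    then show "rval ?f y \<noteq> 0"
      using of_real_rval[OF stable_polyD(1)[OF f], of y] by auto
  qed
  define S where "S i = (\<lambda>k. Some (i, k)) ` {..<r}" for i :: nat
  have S: "finite (S i)" "S i \<subseteq> ?E" "S i \<noteq> {}" "card (S i) = r" for i
    using r by (auto simp: S_def card_image inj_on_def)
  have \<Phi>: "(\<Sum>e\<in>S i. rval (pd e ?f) (\<lambda>_. t) / rval ?f (\<lambda>_. t)) \<le> 1 - 1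
      / (1 + q)" if i: "i < n" for i
  proof -
    have le: "rval (pd e ?f) (\<lambda>_. t) / rval ?f (\<lambda>_. t) \<le> \<delta> / t" if e: "e
        \<in> S i" for e
    proof -
      obtain k where k: "e = Some (i, k)" "k < r" using e by (auto simp: S_def)
      have "rval (pd e ?f) (\<lambda>_. t) = (t ^ n) ^ r * Re (G i i / of_real t)"
        unfolding rval_def k(1) rval_pencil_prod_const(2)[OF t i k(2)]
        by (simp only: times_complex.sel Re_complex_of_real Im_complex_of_real mult_zero_left diff_0_right)
      moreover have "rval ?f (\<lambda>_. t) = (t ^ n) ^ r"
        unfolding rval_def rval_pencil_prod_const(1)[OF t] by simp
      ultimately have "rval (pd e ?f) (\<lambda>_. t) / rval ?f (\<lambda>_. t) = Re (G i i) / t" using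
          t by simp
      then show ?thesis using diag[OF i] t by (simp add: divide_right_mono)
    qed
    from sum_bounded_above[of "S i" "\<lambda>e. rval (pd e ?f) (\<lambda>_. t) / rval ?f (\<lambda>_.
        t)", OF le]
    have "(\<Sum>e\<in>S i. rval (pd e ?f) (\<lambda>_. t) / rval ?f (\<lambda>_. t)) \<le> real r *
        (\<delta> / t)"
      unfolding S(4) .
    also have "\<dots> = q\<^sup>2 / t" unfolding q(2) by (rule times_divide_eq_right)
    also have "\<dots> = q\<^sup>2 / (q * (1 + q))" by (simp add: t_def power2_eq_square distrib_left)
    also have "\<dots> = 1 - 1 / (1 + q)"
    proof -
      have "q\<^sup>2 / (q * (1 + q)) = ((1 + q) - 1) / (1 + q)" using q(1) by (simp add: power2_eq_square)
      also have "\<dots> = 1 - 1 / (1 + q)" using q(1) unfolding diff_divide_distrib by simp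
      finally show ?thesis .
    qed
    finally show ?thesis .
  qed
  have disj: "(\<Sum>T\<leftarrow>map S [0..<n]. of_bool (e \<in> T)) \<le> (1 :: real)" for e
  proof (cases "\<exists>i k. e = Some (i, k)")
    case True
    then obtain i k where e: "e = Some (i, k)" by blast
    have "(\<Sum>T\<leftarrow>map S [0..<n]. of_bool (e \<in> T)) = (\<Sum>j<n. of_bool (e \<in> S j)
        :: real)"
      by (simp add: o_def interv_sum_list_conv_sum_set_nat atLeast0LessThan)
    also have "\<dots> \<le> (\<Sum>j<n. if j = i then 1 else 0)" by (intro sum_mono) (auto simp: e S_def)
    also have "\<dots> \<le> 1" by simp
    finally show ?thesis .
  next
    case False
    then have "(\<Sum>T\<leftarrow>map S [0..<n]. of_bool (e \<in> T)) = (\<Sum>T\<leftarrow>map S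
        [0..<n]. 0 :: real)"
      by (intro arg_cong[where f = sum_list] map_cong) (auto simp: S_def)
    then show ?thesis by simp
  qed
  have "\<exists>es. list_all2 (\<in>) es (map S [0..<n]) \<and> (distinct es \<longrightarrow>
      above_zeros (\<lambda>z. ?f (\<lambda>e. z e - of_nat r * of_bool (e \<in> set es))) (\<lambda>_.
          t + (1 + q)))"
    by (rule stable_poly_selection[OF f _ above _ disj]) (use q(1) S \<Phi> in auto)
  then obtain es where es: "list_all2 (\<in>) es (map S [0..<n])"
    and ab: "distinct es \<Longrightarrow> above_zeros (\<lambda>z. ?f (\<lambda>e. z e - of_nat r *
        of_bool (e \<in> set es))) (\<lambda>_. t + (1 + q))"
    by blast
  have len: "length es = n" using list_all2_lengthD[OF es] by simp
  define s where "s i = snd (the (es ! i))" for i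
  have s: "es ! i = Some (i, s i)" "s i < r" if "i < n" for i
    using list_all2_nthD[OF es, of i] that len by (auto simp: s_def S_def)
  have "distinct es" using s(1) len by (auto simp: distinct_conv_nth)
  have mem: "Some (i, k) \<in> set es \<longleftrightarrow> s i = k" if "i < n" for i k
    using s(1) len that by (auto simp: in_set_conv_nth)
  \<comment> \<open>The coordinate x is left unshifted.\<close>
  have None: "None \<notin> set es" using s(1) len by (auto simp: in_set_conv_nth)
  have bound: "(1 + sqrt (r * \<delta>))\<^sup>2 = t + (1 + q)"
    unfolding q_def[symmetric] t_def by (simp add: power2_eq_square algebra_simps)
  show ?thesis
  proof (intro exI[of _ s] conjI allI impI)
    fix x k assume x: "(1 + sqrt (r * \<delta>))\<^sup>2 \<le> x" and k: "k < r"
    have "rval (\<lambda>z. ?f (\<lambda>e. z e - of_nat r * of_bool (e \<in> set es))) (\<lambda>_. x) > 0"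
      by (rule above_zerosD[OF ab[OF \<open>distinct es\<close>]]) (use x bound in simp)
    then have "?f (\<lambda>e. of_real x - of_nat r * of_bool (e \<in> set es)) \<noteq> 0"
      unfolding rval_def cvec_def by auto
    then have "pencil_det n G (of_real x) (\<lambda>i. of_real x - of_nat r * of_bool (Some (i, k)
        \<in> set es)) \<noteq> 0"
      using k None by (simp add: pencil_prod_def)
    moreover have "pencil n G (of_real x) (\<lambda>i. of_real x - of_nat r * of_bool (Some (i, k)
        \<in> set es)) =
        pencil n G (of_real x) (\<lambda>i. of_real x - of_nat r * of_bool (s i = k))"
      by (rule eq_matI) (auto simp: pencil_index mem)
    ultimately show "pencil_det n G (of_real x) (\<lambda>i. of_real x - of_nat r * of_bool (s i = k))
        \<noteq> 0"
      by (simp add: pencil_det_def)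
  qed (use s(2) in auto)
qed

section \<open>From determinants to Bessel bounds\<close>

lemma cinner_add_right: "cinner x (y + z) = cinner x y + cinner x (z :: 'a :: complex_inner)"
  by (metis cinner_add_left cinner_commute complex_cnj_add)

lemma cinner_scaleC_right: "cinner x (c *\<^sub>C y) = cnj c * cinner x (y :: 'a :: complex_inner)"
  by (metis cinner_commute cinner_scaleC_left complex_cnj_mult)

lemma cnj_cinner: "cnj (cinner x y) = cinner y (x :: 'a :: complex_inner)"
  by (rule cinner_commute[symmetric])

lemma cinner_zero_right: "cinner x 0 = (0 :: complex)" for x :: "'a :: complex_inner"
  using cnj_cinner[of 0 x] by simp

lemma cinner_sum_right: "cinner (y :: 'a :: complex_inner) (\<Sum>i\<in>A. f i) = (\<Sum>i\<in>A.
    cinner y (f i))"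
  by (induction A rule: infinite_finite_induct) (simp_all add: cinner_add_right cinner_zero_right)

lemma cinner_sum_left: "cinner (\<Sum>i\<in>A. f i) (y :: 'a :: complex_inner) = (\<Sum>i\<in>A. cinner
    (f i) y)"
  by (induction A rule: infinite_finite_induct) (simp_all add: cinner_add_left)

lemma cinner_scaleR_left: "cinner (c *\<^sub>R x) y = of_real c * cinner x (y :: 'a :: complex_inner)"
  by (simp add: scaleR_scaleC cinner_scaleC_left)

lemma cinner_scaleR_right: "cinner x (c *\<^sub>R y) = of_real c * cinner x (y :: 'a :: complex_inner)"
  by (simp add: scaleR_scaleC cinner_scaleC_right)

lemma cinner_diff_left: "cinner (x - y) z = cinner x z - cinner y (z :: 'a :: complex_inner)"
  using cinner_add_left[of "x - y" y z] by simp

lemma cinner_diff_right: "cinner x (y - z) = cinner x y - cinner x (z :: 'a :: complex_inner)"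
  using cinner_add_right[of x "y - z" z] by simp

lemma Re_cinner_self: "Re (cinner x x) = (norm (x :: 'a :: complex_inner))\<^sup>2"
  by (simp add: norm_eq_sqrt_cinner cinner_ge_zero)

lemma Im_cinner_self: "Im (cinner x (x :: 'a :: complex_inner)) = 0"
  using cinner_commute[of x x] by (simp add: complex_eq_iff)

lemma norm_diff_scaleR_sq:
  "(norm (y - t *\<^sub>R w))\<^sup>2 = (norm y)\<^sup>2 - 2 * t * Re (cinner y w) + t\<^sup>2 * (norm
      (w :: 'a :: complex_inner))\<^sup>2"
proof -
  have "Re (cinner w y) = Re (cinner y w)" unfolding cinner_commute[of w y] by simp
  then show ?thesis
    unfolding Re_cinner_self[symmetric]
    by (simp add: cinner_diff_left cinner_diff_right cinner_scaleR_left cinner_scaleR_right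
        power2_eq_square algebra_simps)
qed

lemma cmod_diff_of_real_mult_sq:
  "(cmod (a - of_real t * b))\<^sup>2 = (cmod a)\<^sup>2 - 2 * t * Re (a * cnj b) + t\<^sup>2 * (cmod
      b)\<^sup>2"
  unfolding cmod_power2 by (simp add: power2_eq_square algebra_simps)

text \<open>If \<open>q\<^sub>x w = x \<parallel>w\<parallel>\<^sup>2 - c \<Sum>\<^sub>S
    \<bar>\<langle>w, u\<^sub>i\<rangle>\<bar>\<^sup>2\<close> is positive semidefinite and the
        operator behind it is
  invertible, then it is positive definite: with \<open>y\<close> solving \<open>M y = w\<close>,
      expand \<open>0 \<le> q\<^sub>x (y - C w)\<close>.\<close>

lemma semidefinite_imp_definite:
  fixes u :: "nat \<Rightarrow> 'a :: complex_inner"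
  assumes S: "S \<subseteq> {..<n}" and x: "x > 0" and c: "c \<ge> 0"
    and u: "\<And>w i. i < n \<Longrightarrow> (cmod (cinner w (u i)))\<^sup>2 \<le> (norm w)\<^sup>2"
    and psd: "\<And>w. c * (\<Sum>i\<in>S. (cmod (cinner w (u i)))\<^sup>2) \<le> x * (norm w)\<^sup>2"
    and det: "pencil_det n (\<lambda>i j. cinner (u j) (u i)) (of_real x) (\<lambda>i. of_real x -
        of_real c * of_bool (i \<in> S)) \<noteq> 0"
  obtains C where "C > 0" "\<And>w. (norm w)\<^sup>2 \<le> C * (x * (norm w)\<^sup>2 - c *
      (\<Sum>i\<in>S. (cmod (cinner w (u i)))\<^sup>2))"
proof -
  define A where "A = pencil n (\<lambda>i j. cinner (u j) (u i)) (of_real x) (\<lambda>i. of_real x -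
      of_real c * of_bool (i \<in> S))"
  have A: "A \<in> carrier_mat n n" by (simp add: A_def)
  have "Determinant.det A \<noteq> 0" using det by (simp add: A_def pencil_det_def)
  from det_non_zero_imp_unit[OF A this, of "()"]
  obtain B where B: "B \<in> carrier_mat n n" "A * B = 1\<^sub>m n"
    by (auto simp: Units_def ring_mat_def)
  define K where "K = (\<Sum>j<n. \<Sum>k<n. cmod (B $$ (j, k)))"
  have K: "K \<ge> 0" unfolding K_def by (intro sum_nonneg) auto
  \<comment> \<open>Chosen so that \<open>Re (cinner w y)\<close> is at most C |w|^2 for the
    solution y below: 1 and \<open>c * K\<close> bound the contributions of the two summands of x
    y.\<close>
  define C where "C = (1 + c * K) / x"
  have C: "C > 0" using x c K by (simp add: C_def add_pos_nonneg)
  define q where "q w = x * (norm w)\<^sup>2 - c * (\<Sum>i\<in>S. (cmod (cinner w (u i)))\<^sup>2)" for w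
  have fS: "finite S" using S finite_subset by blast
  have "(norm w)\<^sup>2 \<le> C * q w" for w
  proof -
    \<comment> \<open>The equation x y - c sum_S <y, u_i> u_i = w is reduced to finitely many
      unknowns: pairing with u_i, i in S, shows that the coefficients <y, u_i> satisfy the linear
      system A e = h, whose other rows say that e vanishes off S.\<close>
    define h where "h i = of_bool (i \<in> S) * cinner w (u i)" for i
    define e where "e i = (\<Sum>k<n. B $$ (i, k) * h k)" for i
    define y where "y = inverse x *\<^sub>R (w + c *\<^sub>R (\<Sum>j<n. e j *\<^sub>C u j))"
    have xy: "x *\<^sub>R y = w + c *\<^sub>R (\<Sum>j<n. e j *\<^sub>C u j)" using x by (simp add: y_def)
    have eq: "of_real x * e i = of_bool (i \<in> S) * (cinner w (u i) + of_real c * (\<Sum>j<n. e j *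
        cinner (u j) (u i)))"
      if i: "i < n" for i
    proof -
      have "h i = (\<Sum>k<n. (A * B) $$ (i, k) * h k)"
        using i unfolding B(2) by (simp add: if_distrib[of "\<lambda>x. x * _"] cong: if_cong)
      also have "\<dots> = (\<Sum>k<n. \<Sum>j<n. A $$ (i, j) * B $$ (j, k) * h k)"
        using i A B(1) by (simp add: scalar_prod_def atLeast0LessThan sum_distrib_right)
      also have "\<dots> = (\<Sum>j<n. A $$ (i, j) * e j)"
        by (subst sum.swap) (simp add: e_def sum_distrib_left mult.assoc)
      also have "\<dots> = (\<Sum>j<n. (if i = j then of_real x * e j else 0) - of_real c * of_bool (i
          \<in> S) * (e j * cinner (u j) (u i)))"
        using i by (intro sum.cong) (auto simp: A_def pencil_index algebra_simps)
      also have "\<dots> = of_real x * e i - of_real c * of_bool (i \<in> S) * (\<Sum>j<n. e j * cinner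
          (u j) (u i))"
        using i by (simp add: sum_subtractf sum_distrib_left)
      finally show ?thesis unfolding h_def by (simp add: algebra_simps)
    qed
    have e0: "e i = 0" if "i < n" "i \<notin> S" for i using eq[OF that(1)] that(2) x by simp
    have yu: "cinner y (u i) = e i" if "i \<in> S" for i
    proof -
      have "of_real x * cinner y (u i) = cinner (x *\<^sub>R y) (u i)" by (simp add: cinner_scaleR_left)
      also have "\<dots> = cinner w (u i) + of_real c * (\<Sum>j<n. e j * cinner (u j) (u i))"
        unfolding xy by (simp add: cinner_add_left cinner_scaleR_left cinner_sum_left cinner_scaleC_left)
      also have "\<dots> = of_real x * e i" using eq[of i] that S by auto
      finally show ?thesis using x by simp
    qed
    have sumS: "(\<Sum>j<n. e j *\<^sub>C u j) = (\<Sum>j\<in>S. e j *\<^sub>C u j)"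
    proof (rule sum.mono_neutral_right)
      have "0 *\<^sub>C v = (0 :: 'a)" for v :: 'a
        using scaleR_scaleC[of 0 v] by simp
      then show "\<forall>i\<in>{..<n} - S. e i *\<^sub>C u i = 0" using e0 by auto
    qed (use S in auto)
    have polar: "of_real x * cinner y v - of_real c * (\<Sum>i\<in>S. cinner y (u i) * cinner (u i) v)
        = cinner w v" for v
    proof -
      have "of_real x * cinner y v = cinner (x *\<^sub>R y) v" by (simp add: cinner_scaleR_left)
      also have "\<dots> = cinner w v + of_real c * (\<Sum>i\<in>S. e i * cinner (u i) v)"
        unfolding xy sumS by (simp add: cinner_add_left cinner_scaleR_left cinner_sum_left
            cinner_scaleC_left)
      finally show ?thesis using yu by simp
    qed
    have Repolar: "x * Re (cinner y v) - c * (\<Sum>i\<in>S. Re (cinner y (u i) * cnj (cinner v (u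
        i)))) = Re (cinner w v)" for v
    proof -
      show ?thesis
        unfolding cnj_cinner using arg_cong[OF polar[of v], of Re] by (simp only: minus_complex.sel
            Re_sum Im_of_real_mult
          times_complex.sel(1)[of "of_real _"] Re_complex_of_real Im_complex_of_real mult_zero_left
              diff_0_right)
    qed
    have qy: "q y = Re (cinner w y)"
      using Repolar[of y] by (simp only: q_def Re_cinner_self complex_norm_square[symmetric]
          Re_complex_of_real)
    have "Re (cinner w y) \<le> C * (norm w)\<^sup>2"
    proof -
      have "x * Re (cinner w y) = Re (cinner w (x *\<^sub>R y))" by (simp add: cinner_scaleR_right)
      also have "\<dots> = (norm w)\<^sup>2 + c * (\<Sum>j<n. Re (cnj (e j) * cinner w (u j)))"
      proof -
        have "cinner w (\<Sum>j<n. e j *\<^sub>C u j) = (\<Sum>j<n. cnj (e j) * cinner w (u j))"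
          by (simp add: cinner_sum_right cinner_scaleC_right)
        then show ?thesis
          unfolding xy by (simp add: cinner_add_right cinner_scaleR_right Re_cinner_self)
      qed
      also have "(\<Sum>j<n. Re (cnj (e j) * cinner w (u j))) \<le> K * (norm w)\<^sup>2"
        unfolding K_def sum_distrib_right
      proof (rule sum_mono)
        fix j assume "j \<in> {..<n}"
        then have j: "j < n" by simp
        have un: "cmod (cinner w (u i)) \<le> norm w" if "i < n" for i
          using u[OF that, of w] by (rule power2_le_imp_le) simp
        have "cmod (e j) \<le> (\<Sum>k<n. cmod (B $$ (j, k)) * norm w)"
          unfolding e_def
        proof (rule order_trans[OF norm_sum sum_mono])
          fix k assume "k \<in> {..<n}"
          then have "cmod (h k) \<le> norm w" using un[of k] by (auto simp: h_def)
          then show "cmod (B $$ (j, k) * h k) \<le> cmod (B $$ (j, k)) * norm w"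
            unfolding norm_mult by (intro mult_left_mono) auto
        qed
        then have "cmod (e j) * cmod (cinner w (u j)) \<le> (\<Sum>k<n. cmod (B $$ (j, k)) * norm w) *
            norm w"
          using un[OF j] by (intro mult_mono) (auto intro: sum_nonneg)
        moreover have "Re (cnj (e j) * cinner w (u j)) \<le> cmod (e j) * cmod (cinner w (u j))"
          using complex_Re_le_cmod[of "cnj (e j) * cinner w (u j)"] by (simp add: norm_mult)
        ultimately show "Re (cnj (e j) * cinner w (u j)) \<le> (\<Sum>k<n. cmod (B $$ (j, k)) * (norm
            w)\<^sup>2)"
          by (simp add: sum_distrib_right power2_eq_square mult.assoc)
      qed
      then have "(norm w)\<^sup>2 + c * (\<Sum>j<n. Re (cnj (e j) * cinner w (u j))) \<le> (norm
          w)\<^sup>2 + c * (K * (norm w)\<^sup>2)"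
        using c by (intro add_left_mono mult_left_mono) auto
      finally have "x * Re (cinner w y) \<le> (1 + c * K) * (norm w)\<^sup>2" by (simp add:
          distrib_right mult.assoc)
      then have "Re (cinner w y) \<le> ((1 + c * K) * (norm w)\<^sup>2) / x"
        using x by (simp add: pos_le_divide_eq mult.commute)
      then show ?thesis by (simp add: C_def)
    qed
    \<comment> \<open>Because y solves the equation, \<open>Repolar\<close> evaluates the cross term
      to |w|^2. Together with q y <= C |w|^2 this leaves C |w|^2 <= C^2 q w.\<close>
    moreover have "0 \<le> q y - 2 * C * (norm w)\<^sup>2 + C\<^sup>2 * q w"
    proof -
      have "0 \<le> q (y - C *\<^sub>R w)" using psd[of "y - C *\<^sub>R w"] by (simp add: q_def)
      also have "\<dots> = q y - 2 * C * (x * Re (cinner y w) - c * (\<Sum>i\<in>S. Re (cinner y (u i)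
          * cnj (cinner w (u i))))) + C\<^sup>2 * q w"
        unfolding q_def norm_diff_scaleR_sq cinner_diff_left cinner_scaleR_left cmod_diff_of_real_mult_sq
          sum.distrib sum_subtractf sum_distrib_left[symmetric]
        by (simp add: algebra_simps)
      finally show ?thesis unfolding Repolar Re_cinner_self .
    qed
    ultimately have "C * (norm w)\<^sup>2 \<le> C * (C * q w)"
      unfolding qy by (simp add: power2_eq_square)
    then show ?thesis using C by simp
  qed
  then show ?thesis using that[OF C] unfolding q_def by blast
qed

text \<open>The least valid bound x >= \<rho> is attained. If it exceeded \<rho>, the nonzero
  determinant there would make the quadratic form definite with a uniform gap, so a smaller bound
  would still hold. The descent starts from the bound \<open>max \<rho> c\<close> implied by the
  Bessel hypothesis.\<close>

lemma pencil_det_nonzero_imp_bessel: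
  fixes u :: "nat \<Rightarrow> 'a :: complex_inner"
  assumes S: "S \<subseteq> {..<n}" and \<rho>: "\<rho> > 0" and c: "c \<ge> 0"
    and u: "\<And>w. (\<Sum>i<n. (cmod (cinner w (u i)))\<^sup>2) \<le> (norm w)\<^sup>2"
    and det: "\<And>x. x \<ge> \<rho> \<Longrightarrow>
      pencil_det n (\<lambda>i j. cinner (u j) (u i)) (of_real x) (\<lambda>i. of_real x - of_real c *
          of_bool (i \<in> S)) \<noteq> 0"
  shows "c * (\<Sum>i\<in>S. (cmod (cinner w (u i)))\<^sup>2) \<le> \<rho> * (norm w)\<^sup>2"
proof -
  define X where "X = {x. x \<ge> \<rho> \<and> (\<forall>w. c * (\<Sum>i\<in>S. (cmod (cinner w (u
      i)))\<^sup>2) \<le> x * (norm w)\<^sup>2)}"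
  have uS: "(\<Sum>i\<in>S. (cmod (cinner w (u i)))\<^sup>2) \<le> (norm w)\<^sup>2" for w
    by (rule order_trans[OF sum_mono2 u]) (use S in auto)
  have u1: "(cmod (cinner w (u i)))\<^sup>2 \<le> (norm w)\<^sup>2" if "i < n" for w i
    by (rule order_trans[OF member_le_sum u]) (use that in auto)
  have "max \<rho> c \<in> X"
    unfolding X_def
  proof (intro CollectI conjI allI)
    fix w :: 'a
    have "c * (\<Sum>i\<in>S. (cmod (cinner w (u i)))\<^sup>2) \<le> c * (norm w)\<^sup>2" using uS c
        by (intro mult_left_mono) auto
    also have "\<dots> \<le> max \<rho> c * (norm w)\<^sup>2" by (intro mult_right_mono) auto
    finally show "c * (\<Sum>i\<in>S. (cmod (cinner w (u i)))\<^sup>2) \<le> max \<rho> c * (norm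
        w)\<^sup>2" .
  qed simp
  then have ne: "X \<noteq> {}" by blast
  have bdd: "bdd_below X" unfolding X_def by (rule bdd_belowI[of _ \<rho>]) auto
  have "closed X"
  proof -
    have "X = {\<rho>..} \<inter> (\<Inter>w. {x. c * (\<Sum>i\<in>S. (cmod (cinner w (u i)))\<^sup>2)
        \<le> x * (norm w)\<^sup>2})"
      unfolding X_def by auto
    then show ?thesis by (auto intro!: closed_Int closed_INT closed_Collect_le continuous_intros)
  qed
  then have x0: "Inf X \<in> X" by (rule closed_contains_Inf[OF ne bdd])
  define x0 where "x0 = Inf X"
  have x0X: "x0 \<ge> \<rho>" "\<And>w. c * (\<Sum>i\<in>S. (cmod (cinner w (u i)))\<^sup>2) \<le> x0 *
      (norm w)\<^sup>2"
    using x0 unfolding x0_def[symmetric] unfolding X_def by blast+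
  have "x0 = \<rho>"
  proof (rule ccontr)
    assume "x0 \<noteq> \<rho>"
    then have gt: "x0 > \<rho>" using x0X(1) by simp
    have x0pos: "x0 > 0" using gt \<rho> by simp
    obtain C where C: "C > 0" "\<And>w. (norm w)\<^sup>2 \<le> C * (x0 * (norm w)\<^sup>2 - c *
        (\<Sum>i\<in>S. (cmod (cinner w (u i)))\<^sup>2))"
      using semidefinite_imp_definite[OF S x0pos c u1 x0X(2) det[OF x0X(1)]] by blast
    define \<epsilon> where "\<epsilon> = min (1 / C) (x0 - \<rho>)"
    have \<epsilon>: "\<epsilon> > 0" "\<epsilon> \<le> 1 / C" "\<epsilon> \<le> x0 - \<rho>" using
        C(1) gt by (auto simp: \<epsilon>_def)
    have "x0 - \<epsilon> \<in> X"
      unfolding X_def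
    proof (intro CollectI conjI allI)
      fix w :: 'a
      have "\<epsilon> * (norm w)\<^sup>2 \<le> 1 / C * (norm w)\<^sup>2" using \<epsilon>(2) by (intro
          mult_right_mono) auto
      also have "\<dots> \<le> x0 * (norm w)\<^sup>2 - c * (\<Sum>i\<in>S. (cmod (cinner w (u i)))\<^sup>2)"
        using C(2)[of w] C(1) by (simp add: pos_divide_le_eq mult.commute)
      finally show "c * (\<Sum>i\<in>S. (cmod (cinner w (u i)))\<^sup>2) \<le> (x0 - \<epsilon>) *
          (norm w)\<^sup>2"
        by (simp add: left_diff_distrib)
    qed (use \<epsilon> in simp)
    then have "x0 \<le> x0 - \<epsilon>" unfolding x0_def by (rule cInf_lower[OF _ bdd])
    then show False using \<epsilon>(1) by simp
  qed
  then show ?thesis using x0X(2) by simp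
qed

text \<open>For w = sum v_j u_j the vector G v has entries <w, u_i> and <v, G v> = |w|^2, so the
  required inequality is the Bessel bound at w.\<close>

lemma hermitian_contraction_gram:
  fixes u :: "nat \<Rightarrow> 'a :: complex_inner"
  assumes u: "\<And>w. (\<Sum>i<n. (cmod (cinner w (u i)))\<^sup>2) \<le> (norm w)\<^sup>2"
  shows "hermitian_contraction n (\<lambda>i j. cinner (u j) (u i))"
  unfolding hermitian_contraction_def Let_def
proof (intro conjI allI)
  show "cinner (u i) (u j) = cnj (cinner (u j) (u i))" for i j by (rule cinner_commute)
  fix v :: "nat \<Rightarrow> complex"
  define w where "w = (\<Sum>j<n. v j *\<^sub>C u j)"
  have p: "(\<Sum>j<n. cinner (u j) (u i) * v j) = cinner w (u i)" for i
    by (simp add: w_def cinner_sum_left cinner_scaleC_left mult.commute)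
  have "(\<Sum>i<n. v i * cnj (cinner w (u i))) = (\<Sum>i<n. v i * cinner (u i) w)"
    by (simp only: cnj_cinner)
  also have "\<dots> = cinner w w"
    unfolding w_def[symmetric] by (subst (2) w_def) (simp add: cinner_sum_left cinner_scaleC_left)
  finally have Q: "(\<Sum>i<n. v i * cnj (cinner w (u i))) = cinner w w" .
  show "Im (\<Sum>i<n. v i * cnj (\<Sum>j<n. cinner (u j) (u i) * v j)) = 0"
    "(\<Sum>i<n. (cmod (\<Sum>j<n. cinner (u j) (u i) * v j))\<^sup>2) \<le> Re (\<Sum>i<n. v i * cnj
        (\<Sum>j<n. cinner (u j) (u i) * v j))"
    unfolding p Q Re_cinner_self Im_cinner_self using u by simp_all
qed

theorem weaver_finite:
  fixes u :: "'i \<Rightarrow> 'a :: complex_inner"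
  assumes "finite F" and \<delta>: "\<delta> > 0" and r: "r > 0"
    and u: "\<And>w. (\<Sum>i\<in>F. (cmod (cinner w (u i)))\<^sup>2) \<le> (norm w)\<^sup>2"
    and norm: "\<And>i. i \<in> F \<Longrightarrow> (norm (u i))\<^sup>2 \<le> \<delta>"
  shows "\<exists>s. (\<forall>i\<in>F. s i < r) \<and> (\<forall>k<r. \<forall>w.
      (\<Sum>i\<in>{i\<in>F. s i = k}. (cmod (cinner w (u i)))\<^sup>2)
    \<le> (1 / sqrt (real r) + sqrt \<delta>)\<^sup>2 * (norm w)\<^sup>2)"
proof -
  obtain h where h: "bij_betw h {0..<card F} F"
    using ex_bij_betw_nat_finite[OF \<open>finite F\<close>] by blast
  define n where "n = card F"
  have h: "bij_betw h {..<n} F" using h by (simp add: n_def atLeast0LessThan)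
  define v where "v i = u (h i)" for i
  have hF: "h i \<in> F" if "i < n" for i using bij_betwE[OF h] that by blast
  have v: "(\<Sum>i<n. (cmod (cinner w (v i)))\<^sup>2) \<le> (norm w)\<^sup>2" for w
    using u[of w] sum.reindex_bij_betw[OF h, of "\<lambda>i. (cmod (cinner w (u i)))\<^sup>2"] by (simp
        add: v_def)
  have diag: "Re (cinner (v i) (v i)) \<le> \<delta>" if "i < n" for i
    unfolding Re_cinner_self v_def by (rule norm[OF hF[OF that]])
  obtain s where s: "\<And>i. i < n \<Longrightarrow> s i < r"
    and det: "\<And>x k. (1 + sqrt (r * \<delta>))\<^sup>2 \<le> x \<Longrightarrow> k < r \<Longrightarrow>
      pencil_det n (\<lambda>i j. cinner (v j) (v i)) (of_real x) (\<lambda>i. of_real x - of_nat r *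
          of_bool (s i = k)) \<noteq> 0"
    using pencil_det_selection[OF hermitian_contraction_gram[OF v] diag \<delta> r] by blast
  define g where "g = inv_into {..<n} h"
  have g: "g (h i) = i" if "i < n" for i
    unfolding g_def by (rule inv_into_f_f) (use h that in \<open>auto simp: bij_betw_def\<close>)
  have gn: "g j < n" if "j \<in> F" for j
    using inv_into_into[of j h "{..<n}"] h that unfolding g_def bij_betw_def by auto
  \<comment> \<open>The determinants control r times the class sums; this rescales the threshold to
    the bound.\<close>
  have rho: "(1 + sqrt (r * \<delta>))\<^sup>2 / r = (1 / sqrt (real r) + sqrt \<delta>)\<^sup>2"
  proof -
    have "1 / sqrt r + sqrt \<delta> = (1 + sqrt (r * \<delta>)) / sqrt r"
      using r by (simp add: add_divide_distrib real_sqrt_mult)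
    then show ?thesis using r by (simp add: power_divide)
  qed
  show ?thesis
  proof (intro exI[of _ "\<lambda>i. s (g i)"] conjI ballI allI impI)
    show "s (g i) < r" if "i \<in> F" for i using s gn that by blast
    fix k w assume k: "k < r"
    define S where "S = {i\<in>{..<n}. s i = k}"
    have "pencil n (\<lambda>i j. cinner (v j) (v i)) (of_real x) (\<lambda>i. of_real x - of_real
        (real r) * of_bool (i \<in> S)) =
      pencil n (\<lambda>i j. cinner (v j) (v i)) (of_real x) (\<lambda>i. of_real x - of_nat r *
          of_bool (s i = k))" for x
      by (rule eq_matI) (auto simp: pencil_index S_def)
    then have det': "pencil_det n (\<lambda>i j. cinner (v j) (v i)) (of_real x) (\<lambda>i. of_real x
        - of_real (real r) * of_bool (i \<in> S)) \<noteq> 0"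
      if "(1 + sqrt (r * \<delta>))\<^sup>2 \<le> x" for x
      using det[OF that k] by (simp add: pencil_det_def)
    have pos: "0 < (1 + sqrt (real r * \<delta>))\<^sup>2"
      using \<delta> r by (intro zero_less_power add_pos_pos) auto
    have "real r * (\<Sum>i\<in>S. (cmod (cinner w (v i)))\<^sup>2) \<le> (1 + sqrt (r *
        \<delta>))\<^sup>2 * (norm w)\<^sup>2"
      by (rule pencil_det_nonzero_imp_bessel[OF _ pos _ v det']) (auto simp: S_def)
    then have "(\<Sum>i\<in>S. (cmod (cinner w (v i)))\<^sup>2) \<le> (1 + sqrt (r * \<delta>))\<^sup>2
        / r * (norm w)\<^sup>2"
      using r by (simp add: pos_le_divide_eq mult.commute)
    moreover have "(\<Sum>i\<in>S. (cmod (cinner w (v i)))\<^sup>2) = (\<Sum>i\<in>{i\<in>F. s (g i) =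
        k}. (cmod (cinner w (u i)))\<^sup>2)"
      unfolding v_def
    proof (rule sum.reindex_bij_betw)
      have "h ` S = {i\<in>F. s (g i) = k}"
        using h g unfolding S_def bij_betw_def by force
      moreover have "inj_on h S" using h unfolding S_def bij_betw_def inj_on_def by auto
      ultimately show "bij_betw h S {i\<in>F. s (g i) = k}" by (simp add: bij_betw_def)
    qed
    ultimately show "(\<Sum>i\<in>{i\<in>F. s (g i) = k}. (cmod (cinner w (u i)))\<^sup>2) \<le> (1 /
        sqrt (real r) + sqrt \<delta>)\<^sup>2 * (norm w)\<^sup>2"
      unfolding rho by simp
  qed
qed

section \<open>From finite to countable index sets\<close>

lemma convergent_nat_sequence_eventually_const:
  fixes s :: "nat \<Rightarrow> nat"
  assumes "(\<lambda>n. real (s n)) \<longlonglongrightarrow> l"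
  shows "\<exists>c. eventually (\<lambda>n. s n = c) sequentially"
proof -
  obtain N where N: "\<And>n. n \<ge> N \<Longrightarrow> \<bar>real (s n) - l\<bar> < 1 / 2"
    using LIMSEQ_D[OF assms, of "1 / 2"] by auto
  have "s n = s N" if "n \<ge> N" for n
    using N[OF that] N[of N] by linarith
  then show ?thesis unfolding eventually_sequentially by blast
qed

text \<open>Good colourings of an exhausting sequence of finite sets have a pointwise convergent
  subsequence. Its values are natural numbers, hence eventually constant at each index, so on a
  given finite set the limit coincides with some late colouring.\<close>

lemma colouring_compactness:
  fixes I :: "'i set" and P :: "'i set \<Rightarrow> ('i \<Rightarrow> nat) \<Rightarrow> bool"
  assumes "countable I"
    and ex: "\<And>F. finite F \<Longrightarrow> F \<subseteq> I \<Longrightarrow> \<exists>s.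
        (\<forall>i\<in>F. s i < r) \<and> P F s"
    and mono: "\<And>F F' s. F' \<subseteq> F \<Longrightarrow> finite F \<Longrightarrow> P F s
        \<Longrightarrow> P F' s"
    and cong: "\<And>F s s'. (\<And>i. i \<in> F \<Longrightarrow> s i = s' i) \<Longrightarrow> P F s
        \<Longrightarrow> P F s'"
  shows "\<exists>s. (\<forall>i\<in>I. s i < r) \<and> (\<forall>F. finite F \<longrightarrow> F
      \<subseteq> I \<longrightarrow> P F s)"
proof (cases "I = {}")
  case True
  obtain s where "P {} s" using ex[of "{}"] by blast
  then show ?thesis using True by auto
next
  case False
  define F where "F n = from_nat_into I ` {..<n}" for n
  have F: "finite (F n)" "F n \<subseteq> I" for n
    using from_nat_into[OF False] by (auto simp: F_def)
  have "\<exists>s. \<forall>n. (\<forall>i\<in>F n. s n i < r) \<and> P (F n) (s n)"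
    using ex[OF F] by (intro choice allI) 
  then obtain s where s: "\<And>n i. i \<in> F n \<Longrightarrow> s n i < r" "\<And>n. P (F n) (s n)"
      by blast
  \<comment> \<open>Off \<open>F n\<close> the values of \<open>s n\<close> are uncontrolled; the
    default 0 gives the uniform bound for extracting the subsequence, and each index is eventually
    inside.\<close>
  define f where "f n i = (if i \<in> F n then real (s n i) else 0)" for n i
  have "norm (f n i) \<le> real r" for n i using s(1)[of i n] by (auto simp: f_def)
  then obtain k where k: "strict_mono k" "\<And>i. i \<in> I \<Longrightarrow> \<exists>l. (\<lambda>n.
      f (k n) i) \<longlonglongrightarrow> l"
    using function_convergent_subsequence[OF \<open>countable I\<close>, of f "real r"] by blast
  have memF: "eventually (\<lambda>n. i \<in> F (k n)) sequentially" if i: "i \<in> I" for i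
  proof -
    obtain m where m: "from_nat_into I m = i"
      using from_nat_into_surj[OF \<open>countable I\<close> i] by blast
    have "i \<in> F (k n)" if "n \<ge> Suc m" for n
      using strict_mono_imp_increasing[OF k(1), of n] that m by (auto simp: F_def intro!: image_eqI[of
          _ _ m])
    then show ?thesis unfolding eventually_sequentially by blast
  qed
  have "\<exists>c. eventually (\<lambda>n. s (k n) i = c) sequentially" if i: "i \<in> I" for i
  proof -
    obtain l where "(\<lambda>n. f (k n) i) \<longlonglongrightarrow> l" using k(2)[OF i] by blast
    moreover have "eventually (\<lambda>n. f (k n) i = real (s (k n) i)) sequentially"
      using memF[OF i] by eventually_elim (simp add: f_def)
    ultimately have "(\<lambda>n. real (s (k n) i)) \<longlonglongrightarrow> l" by (rule
        Lim_transform_eventually)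
    then show ?thesis by (rule convergent_nat_sequence_eventually_const)
  qed
  then obtain t where t: "\<And>i. i \<in> I \<Longrightarrow> eventually (\<lambda>n. s (k n) i = t i)
      sequentially" by metis
  show ?thesis
  proof (intro exI[of _ t] conjI ballI allI impI)
    fix i assume i: "i \<in> I"
    have "eventually (\<lambda>n. t i < r) sequentially"
      using t[OF i] memF[OF i]
    proof eventually_elim
      case (elim n)
      then show ?case using s(1)[of i "k n"] by simp
    qed
    then show "t i < r" by simp
  next
    fix F' assume F': "finite F'" "F' \<subseteq> I"
    have "eventually (\<lambda>n. \<forall>i\<in>F'. s (k n) i = t i \<and> i \<in> F (k n)) sequentially"
      using F' t memF by (intro eventually_ball_finite ballI eventually_conj) auto
    then obtain n where n: "\<forall>i\<in>F'. s (k n) i = t i \<and> i \<in> F (k n)"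
      using eventually_happens'[OF sequentially_bot] by blast
    have "P F' (s (k n))" by (rule mono[OF _ F(1) s(2)]) (use n in auto)
    then show "P F' t" by (rule cong[rotated]) (use n in auto)
  qed
qed

lemma bessel_sequence_sum_le:
  assumes "bessel_sequence u I B" "finite F" "F \<subseteq> I"
  shows "(\<Sum>i\<in>F. (cmod (cinner w (u i)))\<^sup>2) \<le> B * (norm w)\<^sup>2"
proof -
  have "(\<Sum>i\<in>F. (cmod (cinner w (u i)))\<^sup>2) \<le> (\<Sum>\<^sub>\<infinity>i\<in>I. (cmod
      (cinner w (u i)))\<^sup>2)"
    using assms unfolding bessel_sequence_def by (intro finite_sum_le_infsum) auto
  also have "\<dots> \<le> B * (norm w)\<^sup>2" using assms unfolding bessel_sequence_def by blast
  finally show ?thesis .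
qed

lemma bessel_sequenceI_finite:
  assumes "\<And>F w. finite F \<Longrightarrow> F \<subseteq> I \<Longrightarrow> (\<Sum>i\<in>F.
      (cmod (cinner w (u i)))\<^sup>2) \<le> B * (norm w)\<^sup>2"
  shows "bessel_sequence u I B"
  unfolding bessel_sequence_def
proof (intro allI conjI)
  fix w
  show sm: "(\<lambda>i. (cmod (cinner w (u i)))\<^sup>2) summable_on I"
    using assms[of _ w] by (intro nonneg_bounded_partial_sums_imp_summable_on[of _ _ "B * (norm
        w)\<^sup>2"])
      (auto intro!: eventually_finite_subsets_at_top_weakI)
  show "(\<Sum>\<^sub>\<infinity>i\<in>I. (cmod (cinner w (u i)))\<^sup>2) \<le> B * (norm w)\<^sup>2"
    by (rule infsum_le_finite_sums[OF sm]) (use assms in auto)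
qed

theorem mainTheorem6:
  fixes I :: "'i set" and u :: "'i \<Rightarrow> 'a :: chilbert_space" and \<delta> :: real and r :: nat
  assumes "countable I"
    and "separable_space (euclidean :: 'a topology)"
    and "\<delta> \<ge> 0"
    and "bessel_sequence u I 1"
    and "\<forall>i\<in>I. (norm (u i))\<^sup>2 \<le> \<delta>"
    and "r > 0"
  shows "\<exists>J :: nat \<Rightarrow> 'i set.
           (\<Union>k\<in>{1..r}. J k) = I \<and> disjoint_family_on J {1..r} \<and>
           (\<forall>k\<in>{1..r}. bessel_sequence u (J k) ((1 / sqrt (real r) + sqrt \<delta>)\<^sup>2))"
proof -
  define B where "B = (1 / sqrt (real r) + sqrt \<delta>)\<^sup>2"
  have bessel: "(\<Sum>i\<in>F. (cmod (cinner w (u i)))\<^sup>2) \<le> (norm w)\<^sup>2" if "finite F" "F \<subseteq> I" for F w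
    using bessel_sequence_sum_le[OF assms(4) that] by simp
  define P where "P F s \<longleftrightarrow> (\<forall>k<r. \<forall>w. (\<Sum>i\<in>{i\<in>F. s i = k}. (cmod (cinner w (u i)))\<^sup>2) \<le> B * (norm w)\<^sup>2)"
    for F and s :: "'i \<Rightarrow> nat"
  have ex: "\<exists>s. (\<forall>i\<in>F. s i < r) \<and> P F s" if F: "finite F" "F \<subseteq> I" for F
  \<comment> \<open>The barrier starts at a positive t, which requires \<delta> > 0; for \<delta> =
    0 all vectors vanish and one colour does.\<close>
  proof (cases "\<delta> = 0")
    case True
    have zero: "cinner w (u i) = 0" if "i \<in> F" for w i
    proof -
      have "u i = 0" using assms(5) True F(2) that by auto
      then show ?thesis by (simp add: cinner_zero_right)
    qed
    have "P F (\<lambda>_. 0)" unfolding P_def B_def by (auto simp: zero)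
    then show ?thesis using assms(6) by (intro exI[of _ "\<lambda>_. 0"]) simp
  next
    case False
    then have "\<delta> > 0" using assms(3) by simp
    from weaver_finite[OF F(1) this assms(6) bessel[OF F]] assms(5) F(2)
    show ?thesis unfolding P_def B_def by blast
  qed
  have mono: "P F' s" if "F' \<subseteq> F" "finite F" "P F s" for F F' s
    unfolding P_def
  proof (intro allI impI)
    fix k w assume "k < r"
    then have "(\<Sum>i\<in>{i\<in>F. s i = k}. (cmod (cinner w (u i)))\<^sup>2) \<le> B * (norm w)\<^sup>2"
      using that(3) unfolding P_def by blast
    moreover have "(\<Sum>i\<in>{i\<in>F'. s i = k}. (cmod (cinner w (u i)))\<^sup>2) \<le> (\<Sum>i\<in>{i\<in>F. s i = k}. (cmod (cinner w (u i)))\<^sup>2)"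
      by (rule sum_mono2) (use that in auto)
    ultimately show "(\<Sum>i\<in>{i\<in>F'. s i = k}. (cmod (cinner w (u i)))\<^sup>2) \<le> B * (norm w)\<^sup>2" by linarith
  qed
  have cong: "P F s'" if "\<And>i. i \<in> F \<Longrightarrow> s i = s' i" "P F s" for F s s'
  proof -
    have "{i\<in>F. s' i = k} = {i\<in>F. s i = k}" for k using that(1) by auto
    then show ?thesis using that(2) unfolding P_def by simp
  qed
  have "\<exists>s. (\<forall>i\<in>I. s i < r) \<and> (\<forall>F. finite F \<longrightarrow> F \<subseteq> I \<longrightarrow> P F s)"
    by (rule colouring_compactness[OF assms(1)]) (fact ex, fact mono, fact cong)
  then obtain s where s: "\<And>i. i \<in> I \<Longrightarrow> s i < r" "\<And>F. finite F \<Longrightarrow> F \<subseteq> I \<Longrightarrow> P F s"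
    by blast
  \<comment> \<open>Colours run from 0 to r - 1, classes from 1 to r.\<close>
  define J where "J k = {i\<in>I. s i = k - 1}" for k
  have "(\<Union>k\<in>{1..r}. J k) = I"
  proof (intro equalityI subsetI)
    fix i assume i: "i \<in> I"
    then have "i \<in> J (Suc (s i))" by (simp add: J_def)
    moreover have "Suc (s i) \<in> {1..r}" using s(1)[OF i] by simp
    ultimately show "i \<in> (\<Union>k\<in>{1..r}. J k)" by blast
  qed (auto simp: J_def)
  moreover have "disjoint_family_on J {1..r}"
    unfolding disjoint_family_on_def J_def by auto
  moreover have "bessel_sequence u (J k) B" if k: "k \<in> {1..r}" for k
  proof (rule bessel_sequenceI_finite)
    fix F w assume F: "finite F" "F \<subseteq> J k"
    then have "P F s" using s(2)[of F] by (auto simp: J_def)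
    moreover have "{i\<in>F. s i = k - 1} = F" using F by (auto simp: J_def)
    moreover have "k - 1 < r" using k by auto
    ultimately show "(\<Sum>i\<in>F. (cmod (cinner w (u i)))\<^sup>2) \<le> B * (norm w)\<^sup>2"
      unfolding P_def by metis
  qed
  ultimately show ?thesis unfolding B_def by blast
qed

end
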